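(* Let $E\subseteq\mathbf R^d$ be a non-degenerate parallelepiped, $s,t>0$ with $s+t\ge1$, $f\in(\mathcal E_s^E)'(\mathbf R^d)$, $\psi\in\mathcal E_s^E(\mathbf R^d)$ and $\phi\in\mathcal S_t^s(\mathbf R^d)\setminus\{0\}$. Then $(x,\xi)\mapsto (V_\phi f)(x,\xi)\overline{(V_\phi\psi)(x,\xi)}$ belongs to $L^1(E\times\mathbf R^d)$ and $$(f,\psi)_E=(\|\phi\|_{L^2}^2|E|)^{-1}\int_E\Big(\int_{\mathbf R^d}(V_\phi f)(x,\xi)\overline{(V_\phi\psi)(x,\xi)}\,d\xi\Big)dx.$$ The same holds with $\mathcal E_{0,s}^E$ and $\Sigma_t^s$ in place of $\mathcal E_s^E$ and $\mathcal S_t^s$.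
   Context: Gelfand–Shilov spaces: for $s,t>0$, $\mathcal S_t^s(\mathbf R^d)$ is the set of $f\in C^\infty(\mathbf R^d)$ with $\sup_{\alpha,\beta,x}\frac{|x^\beta\partial^\alpha f(x)|}{h^{|\alpha+\beta|}\alpha!^s\beta!^t}<\infty$ for some $h>0$; $\Sigma_t^s(\mathbf R^d)$ requires this for every $h>0$; duals $(\mathcal S_t^s)'$, $(\Sigma_t^s)'$ with bilinear pairing $\langle\cdot,\cdot\rangle$. Fourier transform $\widehat f(\xi)=(2\pi)^{-d/2}\int f(x)e^{-i\langle x,\xi\rangle}dx$; short-time Fourier transform $V_\phi f(x,\xi)=\mathscr F(f\,\overline{\phi(\cdot-x)})(\xi)$. $E=\{\sum x_ke_k:0\le x_k\le1\}$ for a basis $e_1,\dots,e_d$; $\Lambda_E=\sum\mathbf Z e_k$; dual basis $\langle e_j,e'_k\rangle=2\pi\delta_{jk}$, $\Lambda'_E=\sum\mathbf Z e'_k$; $|E|$ is the volume of $E$; $E$-periodic means invariant under translations by $\Lambda_E$. Gevrey classes: for $s\ge0$, $\mathcal E_s(\mathbf R^d)$ (resp. $\mathcal E_{0,s}(\mathbf R^d)$) consists of $f\in C^\infty$ such that for every compact $K$, $\sup_\alpha\|\partial^\alpha f\|_{L^\infty(K)}/(h^{|\alpha|}\alpha!^s)<\infty$ for some (resp. every) $h>0$; $\mathcal E_s^E$, $\mathcal E_{0,s}^E$ are their $E$-periodic elements, and $(\mathcal E_s^E)'$, $(\mathcal E_{0,s}^E)'$ their duals. For smooth $E$-periodic $\psi$,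 $c(\psi,\alpha)=|E|^{-1}\int_E\psi(x)e^{-i\langle x,\alpha\rangle}dx$. An element $f$ of $(\mathcal E_s^E)'$ (resp. $(\mathcal E_{0,s}^E)'$) is identified with a formal series $\sum_{\alpha\in\Lambda'_E}c(f,\alpha)e^{i\langle\cdot,\alpha\rangle}$ where $|c(f,\alpha)|\lesssim e^{\varepsilon|\alpha|^{1/s}}$ for every (resp. some) $\varepsilon>0$, acting on $\psi$ by $(f,\psi)_E=\sum_{\alpha\in\Lambda'_E}c(f,\alpha)\overline{c(\psi,\alpha)}$; it is regarded as an element of $(\mathcal S_t^s)'$ (resp. $(\Sigma_t^s)'$) via $\langle f,\phi\rangle=(2\pi)^{d/2}\sum_\alpha c(f,\alpha)\widehat\phi(-\alpha)$, so that $V_\phi f$ is defined. *)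

theory Defs
  imports "HOL-Analysis.Analysis"
begin

type_synonym 'n mi = "'n \<Rightarrow> nat"

definition partial :: "'n::finite \<Rightarrow> (real^'n \<Rightarrow> complex) \<Rightarrow> real^'n \<Rightarrow> complex" where
  "partial i f x = vector_derivative (\<lambda>t. f (x + t *\<^sub>R axis i 1)) (at 0)"

fun pderivs :: "'n::finite list \<Rightarrow> (real^'n \<Rightarrow> complex) \<Rightarrow> real^'n \<Rightarrow> complex" where
  "pderivs [] f = f"
| "pderivs (i # is) f = partial i (pderivs is f)"

definition smooth :: "(real^'n::finite \<Rightarrow> complex) \<Rightarrow> bool" where
  "smooth f \<longleftrightarrow> (\<forall>xs. continuous_on UNIV (pderivs xs f) \<and>
      (\<forall>i x. (\<lambda>t. pderivs xs f (x + t *\<^sub>R axis i 1)) differentiable (at 0)))"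

text \<open>\<partial>^\<alpha> f (well defined for smooth f, any order of differentiation)\<close>
definition dmi :: "'n::finite mi \<Rightarrow> (real^'n \<Rightarrow> complex) \<Rightarrow> real^'n \<Rightarrow> complex" where
  "dmi \<alpha> f = pderivs (SOME xs. \<forall>i. count_list xs i = \<alpha> i) f"

definition mi_abs :: "'n::finite mi \<Rightarrow> nat" where
  "mi_abs \<alpha> = (\<Sum>i\<in>UNIV. \<alpha> i)"

definition mi_fact :: "'n::finite mi \<Rightarrow> real" where
  "mi_fact \<alpha> = (\<Prod>i\<in>UNIV. fact (\<alpha> i))"

definition mi_pow :: "real^'n::finite \<Rightarrow> 'n mi \<Rightarrow> real" where
  "mi_pow x \<beta> = (\<Prod>i\<in>UNIV. (x $ i) ^ (\<beta> i))"

definition GS_S :: "real \<Rightarrow> real \<Rightarrow> (real^'n::finite \<Rightarrow> complex) set" where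
  "GS_S s t = {f. smooth f \<and> (\<exists>h>0. \<exists>C. \<forall>\<alpha> \<beta> x.
      cmod (of_real (mi_pow x \<beta>) * dmi \<alpha> f x)
        \<le> C * h ^ (mi_abs \<alpha> + mi_abs \<beta>) * mi_fact \<alpha> powr s * mi_fact \<beta> powr t)}"

definition GS_Sigma :: "real \<Rightarrow> real \<Rightarrow> (real^'n::finite \<Rightarrow> complex) set" where
  "GS_Sigma s t = {f. smooth f \<and> (\<forall>h>0. \<exists>C. \<forall>\<alpha> \<beta> x.
      cmod (of_real (mi_pow x \<beta>) * dmi \<alpha> f x)
        \<le> C * h ^ (mi_abs \<alpha> + mi_abs \<beta>) * mi_fact \<alpha> powr s * mi_fact \<beta> powr t)}"

definition para :: "('n::finite \<Rightarrow> real^'n) \<Rightarrow> (real^'n) set" where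
  "para e = {\<Sum>k\<in>UNIV. x k *\<^sub>R e k | x. \<forall>k. 0 \<le> x k \<and> x k \<le> 1}"

definition lattice :: "('n::finite \<Rightarrow> real^'n) \<Rightarrow> (real^'n) set" where
  "lattice e = {\<Sum>k\<in>UNIV. real_of_int (m k) *\<^sub>R e k | m. True}"

definition dual_basis :: "('n::finite \<Rightarrow> real^'n) \<Rightarrow> 'n \<Rightarrow> real^'n" where
  "dual_basis e k = (THE v. \<forall>j. e j \<bullet> v = (if j = k then 2 * pi else 0))"

definition periodic_on_lattice :: "('n::finite \<Rightarrow> real^'n) \<Rightarrow> (real^'n \<Rightarrow> complex) \<Rightarrow> bool" where
  "periodic_on_lattice e f \<longleftrightarrow> (\<forall>x. \<forall>l\<in>lattice e. f (x + l) = f x)"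

definition Gevrey :: "real \<Rightarrow> (real^'n::finite \<Rightarrow> complex) set" where
  "Gevrey s = {f. smooth f \<and> (\<forall>K. compact K \<longrightarrow> (\<exists>h>0. \<exists>C. \<forall>\<alpha>. \<forall>x\<in>K.
      cmod (dmi \<alpha> f x) \<le> C * h ^ mi_abs \<alpha> * mi_fact \<alpha> powr s))}"

definition Gevrey0 :: "real \<Rightarrow> (real^'n::finite \<Rightarrow> complex) set" where
  "Gevrey0 s = {f. smooth f \<and> (\<forall>K. compact K \<longrightarrow> (\<forall>h>0. \<exists>C. \<forall>\<alpha>. \<forall>x\<in>K.
      cmod (dmi \<alpha> f x) \<le> C * h ^ mi_abs \<alpha> * mi_fact \<alpha> powr s))}"

definition Gevrey_per :: "('n::finite \<Rightarrow> real^'n) \<Rightarrow> real \<Rightarrow> (real^'n \<Rightarrow> complex) set" where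
  "Gevrey_per e s = {f \<in> Gevrey s. periodic_on_lattice e f}"

definition Gevrey0_per :: "('n::finite \<Rightarrow> real^'n) \<Rightarrow> real \<Rightarrow> (real^'n \<Rightarrow> complex) set" where
  "Gevrey0_per e s = {f \<in> Gevrey0 s. periodic_on_lattice e f}"

definition fcoeff :: "('n::finite \<Rightarrow> real^'n) \<Rightarrow> (real^'n \<Rightarrow> complex) \<Rightarrow> real^'n \<Rightarrow> complex" where
  "fcoeff e \<psi> \<alpha> = inverse (complex_of_real (measure lborel (para e))) *
     (LINT x:para e|lborel. \<psi> x * exp (- \<i> * complex_of_real (x \<bullet> \<alpha>)))"

text \<open>Elements of the duals, identified with their coefficient families on the dual lattice.\<close>
definition Gevrey_per_dual :: "('n::finite \<Rightarrow> real^'n) \<Rightarrow> real \<Rightarrow> (real^'n \<Rightarrow> complex) set" where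
  "Gevrey_per_dual e s = {c. \<forall>\<epsilon>>0. \<exists>C. \<forall>\<alpha>\<in>lattice (dual_basis e).
      cmod (c \<alpha>) \<le> C * exp (\<epsilon> * norm \<alpha> powr (1 / s))}"

definition Gevrey0_per_dual :: "('n::finite \<Rightarrow> real^'n) \<Rightarrow> real \<Rightarrow> (real^'n \<Rightarrow> complex) set" where
  "Gevrey0_per_dual e s = {c. \<exists>\<epsilon>>0. \<exists>C. \<forall>\<alpha>\<in>lattice (dual_basis e).
      cmod (c \<alpha>) \<le> C * exp (\<epsilon> * norm \<alpha> powr (1 / s))}"

definition per_pair :: "('n::finite \<Rightarrow> real^'n) \<Rightarrow> (real^'n \<Rightarrow> complex) \<Rightarrow> (real^'n \<Rightarrow> complex) \<Rightarrow> complex" where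
  "per_pair e c \<psi> = (\<Sum>\<^sub>\<infinity>\<alpha>\<in>lattice (dual_basis e). c \<alpha> * cnj (fcoeff e \<psi> \<alpha>))"

definition fourier :: "(real^'n::finite \<Rightarrow> complex) \<Rightarrow> real^'n \<Rightarrow> complex" where
  "fourier g \<xi> = complex_of_real ((2 * pi) powr (- real CARD('n) / 2)) *
     (LINT y|lborel. g y * exp (- \<i> * complex_of_real (y \<bullet> \<xi>)))"

definition dist_pair :: "('n::finite \<Rightarrow> real^'n) \<Rightarrow> (real^'n \<Rightarrow> complex) \<Rightarrow> (real^'n \<Rightarrow> complex) \<Rightarrow> complex" where
  "dist_pair e c \<phi> = complex_of_real ((2 * pi) powr (real CARD('n) / 2)) *
     (\<Sum>\<^sub>\<infinity>\<alpha>\<in>lattice (dual_basis e). c \<alpha> * fourier \<phi> (- \<alpha>))"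

text \<open>STFT of the periodic distribution: F(f conj(phi(.-x)))(xi) = (2pi)^(-d/2) <f, conj(phi(.-x)) e^(-i<.,xi>)>\<close>
definition stft_dist :: "('n::finite \<Rightarrow> real^'n) \<Rightarrow> (real^'n \<Rightarrow> complex) \<Rightarrow> (real^'n \<Rightarrow> complex) \<Rightarrow> real^'n \<Rightarrow> real^'n \<Rightarrow> complex" where
  "stft_dist e \<phi> c x \<xi> = complex_of_real ((2 * pi) powr (- real CARD('n) / 2)) *
     dist_pair e c (\<lambda>y. cnj (\<phi> (y - x)) * exp (- \<i> * complex_of_real (y \<bullet> \<xi>)))"

definition stft :: "(real^'n::finite \<Rightarrow> complex) \<Rightarrow> (real^'n \<Rightarrow> complex) \<Rightarrow> real^'n \<Rightarrow> real^'n \<Rightarrow> complex" where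
  "stft \<phi> g x \<xi> = fourier (\<lambda>y. g y * cnj (\<phi> (y - x))) \<xi>"

end

theory Submission
  imports Defs "HOL-Probability.Sinc_Integral" "HOL-Probability.Characteristic_Functions"
begin

text \<open>
  By definition \<open>V\<^sub>\<phi> f (x, \<xi>)\<close> is the sum over the dual lattice of
  \<open>c(\<alpha>) exp(-i\<langle>x, \<xi> - \<alpha>\<rangle>)\<close> times the conjugate of the Fourier transform of \<open>\<phi>\<close> at \<open>\<alpha> - \<xi>\<close>.
  Substituting \<open>y = x + z\<close> in \<open>V\<^sub>\<phi> \<psi>\<close> and using that integrals of periodic functions over \<open>E\<close> are
  translation invariant, the integral of \<open>exp(i\<langle>x, \<xi> - \<alpha>\<rangle>) V\<^sub>\<phi> \<psi>(x, \<xi>)\<close> over \<open>x \<in> E\<close> is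
  \<open>|E| c(\<psi>, \<alpha>)\<close> times the same conjugated Fourier transform, so that no expansion of \<open>\<psi>\<close> into its
  Fourier series is needed. Integrating in \<open>\<xi>\<close> and applying Plancherel's theorem to \<open>\<phi>\<close> gives
  \<open>|E| \<parallel>\<phi>\<parallel>\<^sup>2 c(\<alpha>)\<close> times the conjugate of \<open>c(\<psi>, \<alpha>)\<close>, and it remains to sum over \<open>\<alpha>\<close>.
  Interchanging sum and integrals is justified by \<open>|\<alpha>|\<^sup>p \<le> 2\<^sup>p (|\<alpha> - \<xi>|\<^sup>p + |\<xi>|\<^sup>p)\<close> with
  \<open>p = 1/s\<close>: both Fourier transforms decay like \<open>exp(-\<delta> |\<cdot>|\<^sup>p)\<close>, which absorbs the growth of \<open>c\<close>
  and leaves a factor \<open>exp(-\<epsilon> |\<alpha>|\<^sup>p) exp(-\<delta> |\<xi>|\<^sup>p / 2)\<close>.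
\<close>

section \<open>Integration over Euclidean space\<close>

text \<open>The bound available for \<open>V_\<phi> f\<close> grows like exp((\<delta>/2)
  |\<xi>|^p), so integrability is obtained only for its product with \<open>V_\<phi> \<psi>\<close>.
  The decay of \<open>V_\<phi> \<psi>\<close> in \<xi> must therefore be uniform in x although
  \<psi> does not decay: periodicity extends the Gevrey bounds of \<psi> from the compact set E to
  the whole space, and the window supplies an integrable weight whose integral is independent of x.
  The rates are tied by \<delta> = 4 * 2^p * \<epsilon>. If a and b are the Gevrey radii of \<psi>
  and \<phi>, Leibniz' rule gives their product the radius a + b, and the resulting rate is \<delta>
  = (s/2) * (d (a + b))^(-1/s) with d the dimension. The two halves of the theorem read this
  relation in opposite directions: in the first the radii are given and \<epsilon> is fitted to
  them, in the second \<epsilon> is given and the radii are chosen small enough. Plancherel's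
  theorem is obtained as Fourier inversion of an autocorrelation at the single point 0, with a
  Gaussian as summability factor; decay provides the square integrability of the transform.\<close>

lemma borel_measurable_cnj [measurable (raw)]:
  "f \<in> borel_measurable M \<Longrightarrow> (\<lambda>x. cnj (f x)) \<in> borel_measurable M"
  by (rule borel_measurable_continuous_on[of cnj]) (intro continuous_intros)

lemma range_axis_eq_Basis: "range (\<lambda>i::'n::finite. axis i (1::real)) = Basis"
  by (auto simp: Basis_vec_def)

text \<open>Lebesgue measure on a Euclidean space is the image of a product measure indexed by
  \<open>Basis\<close>, not by the coordinate type, so the factors are reindexed along
  \<open>axis i 1\<close> before Fubini for finite products applies.\<close>

lemma
  fixes f :: "'n::finite \<Rightarrow> real \<Rightarrow> 'a::{real_normed_field,banach,second_countable_topology}"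
  assumes f: "\<And>i. integrable lborel (f i)"
  shows integrable_prod_components: "integrable lborel (\<lambda>x::real^'n. \<Prod>i\<in>UNIV. f i (x $ i))"
    and integral_prod_components:
      "(LINT x|lborel. (\<Prod>i\<in>UNIV. f i ((x::real^'n) $ i))) = (\<Prod>i\<in>UNIV. (LINT u|lborel. f i u))"
proof -
  interpret product_sigma_finite "\<lambda>_::real^'n. lborel::real measure"
    by standard
  define g :: "real^'n \<Rightarrow> real \<Rightarrow> 'a" where "g b = f (THE i. b = axis i 1)" for b
  have g: "g (axis i 1) = f i" for i
    unfolding g_def by (rule arg_cong[where f = f]) (auto simp: axis_eq_axis)
  have prod_Basis: "(\<Prod>b\<in>Basis. h b) = (\<Prod>i\<in>UNIV. h (axis i 1))" for h :: "real^'n \<Rightarrow> 'a"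
    unfolding range_axis_eq_Basis[symmetric]
    by (subst prod.reindex) (auto simp: inj_on_def axis_eq_axis)
  have eq: "(\<Prod>b\<in>Basis. g b (x \<bullet> b)) = (\<Prod>i\<in>UNIV. f i (x $ i))" for x
    by (simp add: prod_Basis g inner_axis)
  have gi: "integrable lborel (g b)" if "b \<in> Basis" for b
    using that f g by (auto simp flip: range_axis_eq_Basis)
  have gm: "(\<lambda>x::real^'n. \<Prod>b\<in>Basis. g b (x \<bullet> b)) \<in> borel_measurable borel"
  proof (rule borel_measurable_prod)
    fix b :: "real^'n" assume "b \<in> Basis"
    then have "g b \<in> borel_measurable borel"
      using borel_measurable_integrable[OF gi] by simp
    then show "(\<lambda>x. g b (x \<bullet> b)) \<in> borel_measurable borel"
      by (rule measurable_compose[rotated]) simp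
  qed
  have m: "(\<lambda>f. \<Sum>b\<in>Basis. f b *\<^sub>R b) \<in> (\<Pi>\<^sub>M b\<in>(Basis::(real^'n) set). lborel) \<rightarrow>\<^sub>M borel"
    by measurable
  have coord: "(\<Prod>b\<in>Basis. g b ((\<Sum>b\<in>Basis. h b *\<^sub>R b) \<bullet> b)) = (\<Prod>b\<in>Basis. g b (h b))" for h
    by (intro prod.cong refl) simp
  have "integrable (\<Pi>\<^sub>M b\<in>(Basis::(real^'n) set). lborel) (\<lambda>h. \<Prod>b\<in>Basis. g b (h b))"
    by (rule product_integrable_prod) (auto intro: gi)
  then show "integrable lborel (\<lambda>x::real^'n. \<Prod>i\<in>UNIV. f i (x $ i))"
    unfolding eq[symmetric] by (subst lborel_eq, subst integrable_distr_eq[OF m gm]) (simp add: coord)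
  have "(LINT x|lborel. (\<Prod>i\<in>UNIV. f i ((x::real^'n) $ i))) =
      (LINT h|(\<Pi>\<^sub>M b\<in>(Basis::(real^'n) set). lborel). (\<Prod>b\<in>Basis. g b (h b)))"
    unfolding eq[symmetric] by (subst lborel_eq, subst integral_distr[OF m gm]) (simp add: coord)
  also have "\<dots> = (\<Prod>b\<in>Basis. (LINT u|lborel. g b u))"
    by (rule product_integral_prod) (auto intro: gi)
  finally show "(LINT x|lborel. (\<Prod>i\<in>UNIV. f i ((x::real^'n) $ i))) = (\<Prod>i\<in>UNIV. (LINT u|lborel. f i u))"
    by (simp add: prod_Basis g)
qed

text \<open>A product instead of a power of 1 + |y|^2: integrability reduces to the real line, and
  the reciprocal is a finite sum of monomials, the quantities that Gelfand-Shilov seminorms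
  control.\<close>

definition decay_weight :: "real^'n::finite \<Rightarrow> real" where
  "decay_weight y = (\<Prod>i\<in>UNIV. inverse (1 + (y $ i)\<^sup>2))"

lemma decay_weight_pos: "decay_weight y > 0"
  unfolding decay_weight_def by (intro prod_pos) (auto intro: add_pos_nonneg)

lemma decay_weight_le_1: "decay_weight y \<le> 1"
  unfolding decay_weight_def by (intro prod_le_1) (auto intro!: inverse_le_1_iff[THEN iffD2])

lemma integrable_decay_weight: "integrable lborel (decay_weight :: real^'n::finite \<Rightarrow> real)"
proof -
  have "integrable lborel (\<lambda>x::real. inverse (1 + x\<^sup>2))"
    using integrable_inverse_1_plus_square by (simp add: set_integrable_def)
  then show ?thesis
    unfolding decay_weight_def by (rule integrable_prod_components)
qed

text \<open>Multiplying out the product of the factors 1 + (y_i)^2 picks one summand per coordinate.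
  Only exponents 0 and 2 occur, so every monomial is nonnegative.\<close>

lemma inverse_decay_weight:
  "inverse (decay_weight y) = (\<Sum>S\<in>Pow UNIV. mi_pow y (\<lambda>j. if j \<in> S then 2 else 0))"
proof -
  have "inverse (decay_weight y) = (\<Prod>i\<in>UNIV. (y $ i)\<^sup>2 + 1)"
    by (simp add: decay_weight_def flip: prod_inversef) (simp add: add.commute)
  also have "\<dots> = (\<Sum>S\<in>Pow UNIV. (\<Prod>i\<in>S. (y $ i)\<^sup>2) * (\<Prod>i\<in>UNIV-S. 1))"
    by (rule prod_add) simp
  also have "\<dots> = (\<Sum>S\<in>Pow UNIV. mi_pow y (\<lambda>j. if j \<in> S then 2 else 0))"
  proof (rule sum.cong[OF refl])
    fix S :: "'a set"
    have "mi_pow y (\<lambda>j. if j \<in> S then 2 else 0) = (\<Prod>i\<in>UNIV. if i \<in> S then (y $ i)\<^sup>2 else 1)"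
      unfolding mi_pow_def by (rule prod.cong) auto
    then show "(\<Prod>i\<in>S. (y $ i)\<^sup>2) * (\<Prod>i\<in>UNIV-S. 1) = mi_pow y (\<lambda>j. if j \<in> S then 2 else 0)"
      by (simp add: prod.If_cases)
  qed
  finally show ?thesis .
qed

lemma
  fixes f :: "'a::euclidean_space \<Rightarrow> 'b::{banach,second_countable_topology}"
  shows lborel_integral_translate: "(LINT x|lborel. f (x + a)) = (LINT x|lborel. f x)"
    and lborel_integrable_translate_iff: "integrable lborel (\<lambda>x. f (x + a)) \<longleftrightarrow> integrable lborel f"
proof -
  have tr: "integrable lborel (\<lambda>x. g (x + a))" if "integrable lborel g"
    for a :: 'a and g :: "'a \<Rightarrow> 'b"
  proof -
    have "integrable (distr lborel borel ((+) a)) g"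
      using that by (simp add: lborel_distr_plus)
    then have "integrable lborel (\<lambda>x. g (a + x))"
      by (rule integrable_distr[rotated]) simp
    then show ?thesis
      by (simp add: add.commute)
  qed
  show iff: "integrable lborel (\<lambda>x. f (x + a)) \<longleftrightarrow> integrable lborel f"
    using tr[of f a] tr[of "\<lambda>x. f (x + a)" "-a"] by auto
  show "(LINT x|lborel. f (x + a)) = (LINT x|lborel. f x)"
  proof (cases "integrable lborel f")
    case True
    have "(LINT x|lborel. f x) = (LINT x|distr lborel borel ((+) a). f x)"
      by (simp add: lborel_distr_plus)
    also have "\<dots> = (LINT x|lborel. f (a + x))"
      using borel_measurable_integrable[OF True] by (intro integral_distr) auto
    finally show ?thesis by (simp add: add.commute)
  next
    \<comment> \<open>Both sides are then the default value 0 of the Bochner integral.\<close>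
    case False
    then show ?thesis
      using iff by (simp add: not_integrable_integral_eq)
  qed
qed

lemma lborel_integral_scaleR:
  fixes f :: "'a::euclidean_space \<Rightarrow> 'b::{banach,second_countable_topology}"
  assumes [measurable]: "f \<in> borel_measurable borel" and c: "c \<noteq> 0"
  shows "(LINT x|lborel. f x) = \<bar>c\<bar> ^ DIM('a) *\<^sub>R (LINT x|lborel. f (c *\<^sub>R x))"
proof -
  have eq: "lborel = density (distr lborel borel (\<lambda>x::'a. c *\<^sub>R x)) (\<lambda>_. ennreal (\<bar>c\<bar> ^ DIM('a)))"
    using lborel_affine[OF c, of 0] by (simp add: ennreal_power)
  show ?thesis
    by (subst eq, subst integral_density) (auto simp: integral_distr)
qed

lemma lborel_integral_reflect:
  fixes f :: "'a::euclidean_space \<Rightarrow> 'b::{banach,second_countable_topology}"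
  assumes "f \<in> borel_measurable borel"
  shows "(LINT x|lborel. f (- x)) = (LINT x|lborel. f x)"
  using lborel_integral_scaleR[OF assms, of "-1"] by simp

lemma integrable_pair_bound:
  fixes f :: "'a::euclidean_space \<times> 'b::euclidean_space \<Rightarrow> 'c::{banach,second_countable_topology}"
  assumes f: "f \<in> borel_measurable (lborel \<Otimes>\<^sub>M lborel)"
    and a: "integrable lborel a" and b: "integrable lborel (b :: _ \<Rightarrow> real)"
    and le: "\<And>x y. norm (f (x, y)) \<le> a x * b y"
  shows "integrable (lborel \<Otimes>\<^sub>M lborel) f"
proof (rule Bochner_Integration.integrable_bound)
  show "integrable (lborel \<Otimes>\<^sub>M lborel) (\<lambda>(x, y). a x * b y)"
  proof (rule lborel_pair.Fubini_integrable)
    have "(\<lambda>(x, y). a x * b y) \<in> borel_measurable (lborel \<Otimes>\<^sub>M lborel)"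
      using borel_measurable_integrable[OF a] borel_measurable_integrable[OF b] by measurable
    then show "(\<lambda>(x, y). a x * b y) \<in> borel_measurable (lborel \<Otimes>\<^sub>M lborel)" .
    show "integrable lborel (\<lambda>x. LINT y|lborel. norm (case (x, y) of (x, y) \<Rightarrow> a x * b y))"
      using a by (simp add: abs_mult)
  qed (use b in auto)
  show "f \<in> borel_measurable (lborel \<Otimes>\<^sub>M lborel)"
    by (fact f)
  show "AE x in lborel \<Otimes>\<^sub>M lborel. norm (f x) \<le> norm (case x of (x, y) \<Rightarrow> a x * b y)"
    using le by (intro AE_I2) (auto intro: order_trans[OF _ abs_ge_self])
qed

text \<open>For fixed \<open>x\<close>, translation invariance makes the integral of |g(y + L x)|
  over y a constant, so Tonelli leaves a multiple of |k|. The shift \<open>L\<close> is the identity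
  for autocorrelations and t -> t a for averaging along a segment.\<close>

lemma integrable_pair_shear:
  fixes g :: "'b::euclidean_space \<Rightarrow> 'c::{real_normed_algebra,banach,second_countable_topology}"
    and k :: "'a::euclidean_space \<Rightarrow> 'c"
  assumes k: "integrable lborel k" and g: "integrable lborel g"
    and L[measurable]: "L \<in> borel_measurable borel"
  shows "integrable (lborel \<Otimes>\<^sub>M lborel) (\<lambda>(x, y). k x * g (y + L x))"
proof -
  have [measurable]: "k \<in> borel_measurable borel" "g \<in> borel_measurable borel"
    using borel_measurable_integrable[OF k] borel_measurable_integrable[OF g] by auto
  have gx: "integrable lborel (\<lambda>y. g (y + a))" for a
    using g by (simp add: lborel_integrable_translate_iff)
  have "integrable (lborel \<Otimes>\<^sub>M lborel) (\<lambda>(x, y). norm (k x) * norm (g (y + L x)))"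
  proof (rule lborel_pair.Fubini_integrable)
    have "(LINT y|lborel. norm (g (y + a))) = (LINT y|lborel. norm (g y))" for a
      by (rule lborel_integral_translate[of "\<lambda>y. norm (g y)"])
    then show "integrable lborel (\<lambda>x. LINT y|lborel. norm (case (x, y) of (x, y) \<Rightarrow> norm (k x) * norm (g (y + L x))))"
      using k by simp
    show "AE x in lborel. integrable lborel (\<lambda>y. case (x, y) of (x, y) \<Rightarrow> norm (k x) * norm (g (y + L x)))"
      using gx by auto
  qed measurable
  then show ?thesis
  proof (rule Bochner_Integration.integrable_bound)
    show "(\<lambda>(x, y). k x * g (y + L x)) \<in> borel_measurable (lborel \<Otimes>\<^sub>M lborel)"
      by measurable
    show "AE z in lborel \<Otimes>\<^sub>M lborel. norm (case z of (x, y) \<Rightarrow> k x * g (y + L x))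
        \<le> norm (case z of (x, y) \<Rightarrow> norm (k x) * norm (g (y + L x)))"
      by (intro AE_I2) (simp add: case_prod_beta norm_mult_ineq)
  qed
qed

section \<open>Plancherel's theorem\<close>

text \<open>Rescaling by \<delta> turns the integrand into the standard normal density times a
  character, so the value is the characteristic function of the normal distribution at
  -w/\<delta>.\<close>

lemma lborel_integral_gaussian_exp:
  fixes w \<delta> :: real
  assumes \<delta>: "\<delta> > 0"
  shows "integrable lborel (\<lambda>x. exp (- \<i> * complex_of_real (w * x)) * complex_of_real (exp (- (\<delta> * x)\<^sup>2 / 2)))" (is ?int)
    and "(LINT x|lborel. exp (- \<i> * complex_of_real (w * x)) * complex_of_real (exp (- (\<delta> * x)\<^sup>2 / 2)))
      = complex_of_real (sqrt (2 * pi) / \<delta> * exp (- (w / \<delta>)\<^sup>2 / 2))" (is ?eq)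
proof -
  define f where "f x = complex_of_real (std_normal_density x) * exp (\<i> * complex_of_real ((- w / \<delta>) * x))" for x
  have "f = (\<lambda>x. std_normal_density x *\<^sub>R iexp ((- w / \<delta>) * x))"
    by (rule ext) (simp add: f_def scaleR_conv_of_real)
  then have int: "integrable lborel f" and
    val: "(LINT x|lborel. f x) = complex_of_real (exp (- (w / \<delta>)\<^sup>2 / 2))"
  proof -
    assume f: "f = (\<lambda>x. std_normal_density x *\<^sub>R iexp ((- w / \<delta>) * x))"
    show "integrable lborel f"
    proof (rule Bochner_Integration.integrable_bound)
      show "integrable lborel std_normal_density" by simp
      show "AE x in lborel. norm (f x) \<le> norm (std_normal_density x)"
        by (simp add: f_def norm_mult)
      show "f \<in> borel_measurable lborel" unfolding f by measurable
    qed
    have "(LINT x|lborel. f x) = char std_normal_distribution (- w / \<delta>)"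
      unfolding char_def f by (subst integral_density) auto
    then show "(LINT x|lborel. f x) = complex_of_real (exp (- (w / \<delta>)\<^sup>2 / 2))"
      by (simp add: char_std_normal_distribution)
  qed
  have f\<delta>: "complex_of_real (sqrt (2 * pi)) * f (\<delta> * x) =
      exp (- \<i> * complex_of_real (w * x)) * complex_of_real (exp (- (\<delta> * x)\<^sup>2 / 2))" for x
    using \<delta> by (simp add: f_def std_normal_density_def)
  have "integrable lborel (\<lambda>x. complex_of_real (sqrt (2 * pi)) * f (\<delta> * x))"
    using lborel_integrable_real_affine[OF int, of \<delta> 0] \<delta> by simp
  then show ?int
    unfolding f\<delta> .
  have "(LINT x|lborel. f x) = \<delta> *\<^sub>R (LINT x|lborel. f (\<delta> * x))"
    using lborel_integral_real_affine[of \<delta> f 0] \<delta> by simp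
  then have "(LINT x|lborel. complex_of_real (sqrt (2 * pi)) * f (\<delta> * x)) =
      complex_of_real (sqrt (2 * pi) / \<delta> * exp (- (w / \<delta>)\<^sup>2 / 2))"
    using \<delta> val by (simp add: scaleR_conv_of_real field_simps)
  then show ?eq
    unfolding f\<delta> .
qed

lemma power2_norm_vec: "(norm (x::real^'n::finite))\<^sup>2 = (\<Sum>i\<in>UNIV. (x $ i)\<^sup>2)"
  unfolding power2_norm_eq_inner by (simp add: inner_vec_def power2_eq_square)

lemma lborel_integral_gaussian_vec_exp:
  fixes w :: "real^'n::finite"
  assumes \<delta>: "\<delta> > 0"
  shows "integrable lborel (\<lambda>x. exp (- \<i> * complex_of_real (w \<bullet> x)) * complex_of_real (exp (- (\<delta> * norm x)\<^sup>2 / 2)))" (is ?int)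
    and "(LINT x|lborel. exp (- \<i> * complex_of_real (w \<bullet> x)) * complex_of_real (exp (- (\<delta> * norm x)\<^sup>2 / 2)))
      = complex_of_real ((sqrt (2 * pi) / \<delta>) ^ CARD('n) * exp (- (norm w / \<delta>)\<^sup>2 / 2))" (is ?eq)
proof -
  have prod: "exp (- \<i> * complex_of_real (w \<bullet> x)) * complex_of_real (exp (- (\<delta> * norm x)\<^sup>2 / 2)) =
     (\<Prod>i\<in>UNIV. exp (- \<i> * complex_of_real (w $ i * x $ i)) * complex_of_real (exp (- (\<delta> * x $ i)\<^sup>2 / 2)))"
    for x :: "real^'n"
  proof -
    have "(\<Prod>i\<in>UNIV. exp (- \<i> * complex_of_real (w $ i * x $ i))) = exp (- \<i> * complex_of_real (w \<bullet> x))"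
      by (simp add: inner_vec_def exp_sum[symmetric] sum_distrib_left sum_negf)
    moreover have "(\<Prod>i\<in>UNIV. exp (- (\<delta> * x $ i)\<^sup>2 / 2)) = exp (- (\<delta> * norm x)\<^sup>2 / 2)"
      by (simp add: exp_sum[symmetric] power_mult_distrib power2_norm_vec sum_distrib_left sum_negf sum_divide_distrib)
    ultimately show ?thesis
      by (simp add: prod.distrib flip: of_real_prod)
  qed
  show ?int
    unfolding prod by (rule integrable_prod_components) (rule lborel_integral_gaussian_exp[OF \<delta>])
  have gauss: "(\<Prod>i\<in>UNIV. exp (- (w $ i / \<delta>)\<^sup>2 / 2)) = exp (- (norm w / \<delta>)\<^sup>2 / 2)"
    by (simp add: exp_sum[symmetric] power_divide power2_norm_vec sum_negf sum_divide_distrib)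
  show ?eq
    unfolding prod
    by (subst integral_prod_components[OF lborel_integral_gaussian_exp(1)[OF \<delta>]],
        simp only: lborel_integral_gaussian_exp(2)[OF \<delta>] of_real_prod[symmetric] prod.distrib gauss) simp
qed

context
  fixes \<phi> :: "real^'n::finite \<Rightarrow> complex" and M :: real
  assumes cont: "continuous_on UNIV \<phi>"
    and bdd: "\<And>y. cmod (\<phi> y) \<le> M"
    and int: "integrable lborel \<phi>"
begin

text \<open>The Fourier transform of this function is the squared modulus of that of \<phi>, and its
  value at 0 is the squared L2 norm of \<phi>. Plancherel's theorem is thus inversion at one
  point.\<close>

definition autocorrelation :: "real^'n \<Rightarrow> complex" where
  "autocorrelation w = (LINT y|lborel. cnj (\<phi> y) * \<phi> (y + w))"

lemma borel_measurable_window [measurable]: "\<phi> \<in> borel_measurable borel"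
  using cont by (rule borel_measurable_continuous_onI)

lemma integrable_norm_window: "integrable lborel (\<lambda>y. cmod (\<phi> y))"
  using int by simp

lemma integrable_autocorrelation_pair:
  "integrable (lborel \<Otimes>\<^sub>M lborel) (\<lambda>(y, w). cnj (\<phi> y) * \<phi> (w + y))"
  using int by (intro integrable_pair_shear) auto

lemma integrable_autocorrelation: "integrable lborel autocorrelation"
  using lborel_pair.integrable_snd[OF integrable_autocorrelation_pair]
  unfolding autocorrelation_def by (simp add: add.commute)

lemma norm_autocorrelation_le: "cmod (autocorrelation w) \<le> (LINT y|lborel. cmod (\<phi> y) * M)"
  unfolding autocorrelation_def
proof (rule Bochner_Integration.integral_norm_bound_integral)
  show M: "integrable lborel (\<lambda>y. cmod (\<phi> y) * M)"
    using integrable_norm_window by simp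
  show le: "norm (cnj (\<phi> y) * \<phi> (y + w)) \<le> cmod (\<phi> y) * M" for y
    by (simp add: norm_mult bdd mult_left_mono)
  show "integrable lborel (\<lambda>y. cnj (\<phi> y) * \<phi> (y + w))"
    by (rule Bochner_Integration.integrable_bound[OF M]) (auto intro!: order_trans[OF le])
qed

lemma tendsto_autocorrelation:
  assumes "(\<lambda>n. x n) \<longlonglongrightarrow> 0"
  shows "(\<lambda>n. autocorrelation (x n)) \<longlonglongrightarrow> autocorrelation 0"
  unfolding autocorrelation_def
proof (rule integral_dominated_convergence[where w = "\<lambda>y. cmod (\<phi> y) * M"])
  show "integrable lborel (\<lambda>y. cmod (\<phi> y) * M)"
    using integrable_norm_window by simp
  show "AE y in lborel. (\<lambda>n. cnj (\<phi> y) * \<phi> (y + x n)) \<longlonglongrightarrow> cnj (\<phi> y) * \<phi> (y + 0)"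
  proof (rule AE_I2)
    fix y
    have "(\<lambda>n. y + x n) \<longlonglongrightarrow> y + 0"
      by (intro tendsto_intros assms)
    moreover have "isCont \<phi> (y + 0)"
      using cont by (simp add: continuous_on_eq_continuous_at)
    ultimately have "(\<lambda>n. \<phi> (y + x n)) \<longlonglongrightarrow> \<phi> (y + 0)"
      by (rule isCont_tendsto_compose[rotated])
    then show "(\<lambda>n. cnj (\<phi> y) * \<phi> (y + x n)) \<longlonglongrightarrow> cnj (\<phi> y) * \<phi> (y + 0)"
      by (intro tendsto_intros)
  qed
qed (auto simp: norm_mult bdd mult_left_mono)

lemma fourier_autocorrelation:
  "(LINT w|lborel. autocorrelation w * exp (- \<i> * complex_of_real (w \<bullet> \<eta>))) =
     complex_of_real ((cmod (LINT y|lborel. \<phi> y * exp (- \<i> * complex_of_real (y \<bullet> \<eta>))))\<^sup>2)"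
proof -
  let ?e = "\<lambda>y. exp (- \<i> * complex_of_real (y \<bullet> \<eta>))"
  let ?F = "LINT y|lborel. \<phi> y * ?e y"
  \<comment> \<open>Splitting the character this way attaches one factor to each copy of \<phi>, so
    the double integral becomes a product after the shear.\<close>
  have e: "cnj (?e y) * ?e (w + y) = ?e w" for w y
    by (simp add: exp_cnj exp_add[symmetric] inner_add_left algebra_simps)
  have eq: "cnj (\<phi> y) * \<phi> (w + y) * ?e w = cnj (\<phi> y * ?e y) * (\<phi> (w + y) * ?e (w + y))" for w y
    by (subst e[of y w, symmetric]) (simp add: mult_ac)
  have tr: "(LINT w|lborel. \<phi> (w + y) * ?e (w + y)) = ?F" for y
    by (rule lborel_integral_translate[of "\<lambda>w. \<phi> w * ?e w"])
  have "integrable (lborel \<Otimes>\<^sub>M lborel) (\<lambda>(y, w). cnj (\<phi> y) * \<phi> (w + y) * ?e w)"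
    by (rule Bochner_Integration.integrable_bound[OF integrable_autocorrelation_pair]) (auto simp: norm_mult)
  then have "(LINT w|lborel. (LINT y|lborel. cnj (\<phi> y) * \<phi> (w + y) * ?e w)) =
      (LINT y|lborel. (LINT w|lborel. cnj (\<phi> y) * \<phi> (w + y) * ?e w))"
    by (rule lborel_pair.Fubini_integral)
  also have "\<dots> = (LINT y|lborel. (LINT w|lborel. cnj (\<phi> y * ?e y) * (\<phi> (w + y) * ?e (w + y))))"
    by (simp only: eq)
  also have "\<dots> = (LINT y|lborel. cnj (\<phi> y * ?e y) * ?F)"
    by (simp only: integral_mult_right_zero tr)
  also have "\<dots> = cnj ?F * ?F"
    by (simp del: complex_cnj_mult)
  also have "\<dots> = complex_of_real ((cmod ?F)\<^sup>2)"
    by (simp only: complex_norm_square mult.commute)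
  finally show ?thesis
    by (simp add: autocorrelation_def add.commute)
qed

text \<open>The Gaussian makes the double integral absolutely convergent, so Fubini moves the
  Fourier integral onto it. Its transform is a Gaussian of width \<delta>, and the substitution w =
  \<delta> v leaves \<delta> only inside the autocorrelation.\<close>

lemma gaussian_mollified_plancherel:
  assumes \<delta>: "\<delta> > 0"
  shows "(LINT \<eta>|lborel. complex_of_real ((cmod (LINT y|lborel. \<phi> y * exp (- \<i> * complex_of_real (y \<bullet> \<eta>))))\<^sup>2)
       * complex_of_real (exp (- (\<delta> * norm \<eta>)\<^sup>2 / 2)))
     = complex_of_real (sqrt (2 * pi) ^ CARD('n)) *
       (LINT v|lborel. autocorrelation (\<delta> *\<^sub>R v) * complex_of_real (exp (- (norm v)\<^sup>2 / 2)))"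
proof -
  let ?g = "\<lambda>\<eta>::real^'n. complex_of_real (exp (- (\<delta> * norm \<eta>)\<^sup>2 / 2))"
  let ?e = "\<lambda>w \<eta>. exp (- \<i> * complex_of_real (w \<bullet> \<eta>))"
  have [measurable]: "autocorrelation \<in> borel_measurable borel"
    using borel_measurable_integrable[OF integrable_autocorrelation] by simp
  have intg: "integrable lborel (\<lambda>\<eta>. cmod (?g \<eta>))"
    using integrable_norm[OF lborel_integral_gaussian_vec_exp(1)[OF \<delta>, of 0]] by simp
  have "integrable (lborel \<Otimes>\<^sub>M lborel) (\<lambda>(w, \<eta>). autocorrelation w * ?e w \<eta> * ?g \<eta>)"
    by (rule integrable_pair_bound[OF _ integrable_norm[OF integrable_autocorrelation] intg])
      (auto simp: norm_mult)
  then have "(LINT \<eta>|lborel. (LINT w|lborel. autocorrelation w * ?e w \<eta> * ?g \<eta>)) =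
      (LINT w|lborel. (LINT \<eta>|lborel. autocorrelation w * ?e w \<eta> * ?g \<eta>))"
    by (rule lborel_pair.Fubini_integral)
  also have "\<dots> = (LINT w|lborel. autocorrelation w * complex_of_real ((sqrt (2 * pi) / \<delta>) ^ CARD('n) * exp (- (norm w / \<delta>)\<^sup>2 / 2)))"
    unfolding mult.assoc lborel_integral_gaussian_vec_exp(2)[OF \<delta>, symmetric]
    by simp
  also have "\<dots> = \<delta> ^ CARD('n) *\<^sub>R (LINT v|lborel. autocorrelation (\<delta> *\<^sub>R v) *
      complex_of_real ((sqrt (2 * pi) / \<delta>) ^ CARD('n) * exp (- (norm (\<delta> *\<^sub>R v) / \<delta>)\<^sup>2 / 2)))"
    using \<delta> by (subst lborel_integral_scaleR[of _ \<delta>]) auto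
  also have "\<dots> = \<delta> ^ CARD('n) *\<^sub>R (LINT v|lborel. complex_of_real ((sqrt (2 * pi) / \<delta>) ^ CARD('n)) *
      (autocorrelation (\<delta> *\<^sub>R v) * complex_of_real (exp (- (norm v)\<^sup>2 / 2))))"
    using \<delta> by (simp add: mult_ac)
  also have "\<dots> = complex_of_real (sqrt (2 * pi) ^ CARD('n)) *
       (LINT v|lborel. autocorrelation (\<delta> *\<^sub>R v) * complex_of_real (exp (- (norm v)\<^sup>2 / 2)))"
    using \<delta> by (simp add: scaleR_conv_of_real power_divide)
  finally show ?thesis
    unfolding fourier_autocorrelation[symmetric] by simp
qed

text \<open>The mollified identity is taken to the limit \<delta> -> 0. On the left the assumed
  integrability gives the dominating function, on the right a constant times a Gaussian does, and
  the autocorrelation tends to its value at 0.\<close>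

lemma plancherel:
  assumes sq: "integrable lborel (\<lambda>\<eta>. (cmod (fourier \<phi> \<eta>))\<^sup>2)"
  shows "(LINT \<eta>|lborel. (cmod (fourier \<phi> \<eta>))\<^sup>2) = (LINT y|lborel. (cmod (\<phi> y))\<^sup>2)"
proof -
  define P where "P \<eta> = (cmod (LINT y|lborel. \<phi> y * exp (- \<i> * complex_of_real (y \<bullet> \<eta>))))\<^sup>2" for \<eta>
  have P: "(cmod (fourier \<phi> \<eta>))\<^sup>2 = P \<eta> / (2 * pi) ^ CARD('n)" for \<eta>
  proof -
    have "((2 * pi) powr (- real CARD('n) / 2))\<^sup>2 = (2 * pi) powr (- real CARD('n))"
      by (simp add: power2_eq_square flip: powr_add)
    also have "\<dots> = inverse ((2 * pi) ^ CARD('n))"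
      by (simp add: powr_minus powr_realpow)
    finally have K: "((2 * pi) powr (- real CARD('n) / 2))\<^sup>2 = inverse ((2 * pi) ^ CARD('n))" .
    have "(cmod (fourier \<phi> \<eta>))\<^sup>2 = ((2 * pi) powr (- real CARD('n) / 2))\<^sup>2 * P \<eta>"
      by (simp add: fourier_def P_def norm_mult power_mult_distrib)
    then show ?thesis
      unfolding K by (simp add: field_simps)
  qed
  have P0: "P \<eta> \<ge> 0" for \<eta>
    by (simp add: P_def)
  have intP: "integrable lborel P"
    using integrable_mult_right[OF sq, of "(2 * pi) ^ CARD('n)"] by (simp add: P)
  have auto0: "autocorrelation 0 = complex_of_real (LINT y|lborel. (cmod (\<phi> y))\<^sup>2)"
    unfolding autocorrelation_def
    by (simp add: complex_norm_square mult.commute del: of_real_power integral_complex_of_real flip: integral_complex_of_real)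
  have gauss: "integrable lborel (\<lambda>v::real^'n. exp (- (norm v)\<^sup>2 / 2))"
    using integrable_norm[OF lborel_integral_gaussian_vec_exp(1)[of 1 "0::real^'n"]] by simp
  have gauss_val: "(LINT v|lborel. complex_of_real (exp (- (norm (v::real^'n))\<^sup>2 / 2))) = complex_of_real (sqrt (2 * pi) ^ CARD('n))"
    using lborel_integral_gaussian_vec_exp(2)[of 1 "0::real^'n"] by simp
  define \<delta> where "\<delta> n = inverse (real (Suc n))" for n
  have \<delta>0: "\<delta> \<longlonglongrightarrow> 0"
    unfolding \<delta>_def by (rule LIMSEQ_inverse_real_of_nat)
  have [measurable]: "P \<in> borel_measurable borel" "autocorrelation \<in> borel_measurable borel"
    using borel_measurable_integrable[OF intP] borel_measurable_integrable[OF integrable_autocorrelation] by auto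
  have "(\<lambda>n. LINT \<eta>|lborel. complex_of_real (P \<eta>) * complex_of_real (exp (- (\<delta> n * norm \<eta>)\<^sup>2 / 2)))
      \<longlonglongrightarrow> (LINT \<eta>|lborel. complex_of_real (P \<eta>))"
  proof (rule integral_dominated_convergence[where w = P])
    show "AE \<eta> in lborel. (\<lambda>n. complex_of_real (P \<eta>) * complex_of_real (exp (- (\<delta> n * norm \<eta>)\<^sup>2 / 2)))
        \<longlonglongrightarrow> complex_of_real (P \<eta>)"
    proof (rule AE_I2)
      fix \<eta> :: "real^'n"
      have "(\<lambda>n. complex_of_real (P \<eta>) * complex_of_real (exp (- (\<delta> n * norm \<eta>)\<^sup>2 / 2)))
        \<longlonglongrightarrow> complex_of_real (P \<eta>) * complex_of_real (exp (- (0 * norm \<eta>)\<^sup>2 / 2))"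
        by (intro tendsto_intros \<delta>0) auto
      then show "(\<lambda>n. complex_of_real (P \<eta>) * complex_of_real (exp (- (\<delta> n * norm \<eta>)\<^sup>2 / 2)))
        \<longlonglongrightarrow> complex_of_real (P \<eta>)" by simp
    qed
    show "AE \<eta> in lborel. norm (complex_of_real (P \<eta>) * complex_of_real (exp (- (\<delta> n * norm \<eta>)\<^sup>2 / 2))) \<le> P \<eta>" for n
      using P0 by (intro AE_I2) (auto simp: norm_mult mult_left_le)
  qed (use intP in auto)
  moreover have "(\<lambda>n. complex_of_real (sqrt (2 * pi) ^ CARD('n)) *
       (LINT v|lborel. autocorrelation (\<delta> n *\<^sub>R v) * complex_of_real (exp (- (norm v)\<^sup>2 / 2))))
     \<longlonglongrightarrow> complex_of_real (sqrt (2 * pi) ^ CARD('n)) *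
       (LINT v|(lborel::(real^'n) measure). autocorrelation 0 * complex_of_real (exp (- (norm v)\<^sup>2 / 2)))"
  proof (intro tendsto_intros integral_dominated_convergence[where w = "\<lambda>v. (LINT y|lborel. cmod (\<phi> y) * M) * exp (- (norm v)\<^sup>2 / 2)"])
    show "AE v in lborel. (\<lambda>n. autocorrelation (\<delta> n *\<^sub>R v) * complex_of_real (exp (- (norm v)\<^sup>2 / 2)))
        \<longlonglongrightarrow> autocorrelation 0 * complex_of_real (exp (- (norm v)\<^sup>2 / 2))"
    proof (rule AE_I2)
      fix v :: "real^'n"
      have "(\<lambda>n. \<delta> n *\<^sub>R v) \<longlonglongrightarrow> 0 *\<^sub>R v"
        by (intro tendsto_intros \<delta>0)
      then show "(\<lambda>n. autocorrelation (\<delta> n *\<^sub>R v) * complex_of_real (exp (- (norm v)\<^sup>2 / 2)))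
        \<longlonglongrightarrow> autocorrelation 0 * complex_of_real (exp (- (norm v)\<^sup>2 / 2))"
        by (intro tendsto_intros tendsto_autocorrelation) simp
    qed
    show "AE v in lborel. norm (autocorrelation (\<delta> n *\<^sub>R v) * complex_of_real (exp (- (norm v)\<^sup>2 / 2)))
       \<le> (LINT y|lborel. cmod (\<phi> y) * M) * exp (- (norm v)\<^sup>2 / 2)" for n
      using norm_autocorrelation_le by (intro AE_I2) (auto simp: norm_mult intro!: mult_right_mono)
  qed (use gauss in auto)
  moreover have "(\<lambda>n. LINT \<eta>|lborel. complex_of_real (P \<eta>) * complex_of_real (exp (- (\<delta> n * norm \<eta>)\<^sup>2 / 2))) =
      (\<lambda>n. complex_of_real (sqrt (2 * pi) ^ CARD('n)) *
       (LINT v|lborel. autocorrelation (\<delta> n *\<^sub>R v) * complex_of_real (exp (- (norm v)\<^sup>2 / 2))))"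
    unfolding P_def by (rule ext, rule gaussian_mollified_plancherel) (simp add: \<delta>_def)
  ultimately have "(LINT \<eta>|lborel. complex_of_real (P \<eta>)) = complex_of_real (sqrt (2 * pi) ^ CARD('n)) *
       (LINT v|(lborel::(real^'n) measure). autocorrelation 0 * complex_of_real (exp (- (norm v)\<^sup>2 / 2)))"
    by (auto intro: LIMSEQ_unique)
  \<comment> \<open>One factor comes from the mollified identity, the other from the total mass of
    the Gaussian; together they cancel the squared normalization of \<open>fourier\<close>.\<close>
  also have "\<dots> = complex_of_real (sqrt (2 * pi) ^ CARD('n) * sqrt (2 * pi) ^ CARD('n) * (LINT y|lborel. (cmod (\<phi> y))\<^sup>2))"
    unfolding integral_mult_right_zero gauss_val auto0 of_real_mult by (simp only: mult_ac)
  also have "sqrt (2 * pi) ^ CARD('n) * sqrt (2 * pi) ^ CARD('n) = (2 * pi) ^ CARD('n)"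
    by (simp only: power_mult_distrib[symmetric] real_sqrt_mult_self) simp
  finally have "(LINT \<eta>|lborel. P \<eta>) = (2 * pi) ^ CARD('n) * (LINT y|lborel. (cmod (\<phi> y))\<^sup>2)"
    by (simp only: integral_complex_of_real of_real_eq_iff)
  then show ?thesis
    by (simp add: P)
qed

end

section \<open>Decay of Fourier transforms\<close>

text \<open>By translation invariance the integral of \<open>F'\<close> equals its average over the
  shifts t a with t in [0,1]. After Fubini the inner integral is F(y + a) - F(y), whose integral is
  0 by invariance again; no boundary term at infinity has to be estimated.\<close>

lemma integral_partial_derivative_eq_0:
  fixes F F' :: "real^'n::finite \<Rightarrow> complex"
  assumes F: "integrable lborel F" and F': "integrable lborel F'"
    and cont: "continuous_on UNIV F'"
    and deriv: "\<And>y. ((\<lambda>t. F (y + t *\<^sub>R a)) has_vector_derivative F' y) (at 0)"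
  shows "(LINT y|lborel. F' y) = 0"
proof -
  let ?I = "\<lambda>t. indicator {0..1::real} t :: complex"
  \<comment> \<open>The hypothesis differentiates only at parameter 0, but at every base point;
    moving the base point along the line gives every parameter.\<close>
  have deriv': "((\<lambda>t. F (y + t *\<^sub>R a)) has_vector_derivative F' (y + t *\<^sub>R a)) (at t within S)" for y t S
  proof -
    have "((\<lambda>u. F (y + t *\<^sub>R a + u *\<^sub>R a)) has_vector_derivative F' (y + t *\<^sub>R a)) (at (t - t))"
      using deriv[of "y + t *\<^sub>R a"] by simp
    moreover have "((\<lambda>u. u - t) has_vector_derivative 1) (at t)"
      by (auto intro!: derivative_eq_intros)
    ultimately have "(((\<lambda>u. F (y + t *\<^sub>R a + u *\<^sub>R a)) \<circ> (\<lambda>u. u - t)) has_vector_derivative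
        1 *\<^sub>R F' (y + t *\<^sub>R a)) (at t)"
      by (intro vector_diff_chain_at)
    then have "((\<lambda>t. F (y + t *\<^sub>R a)) has_vector_derivative F' (y + t *\<^sub>R a)) (at t)"
      by (simp add: o_def algebra_simps)
    then show ?thesis
      by (rule has_vector_derivative_at_within)
  qed
  have ftc: "(LINT t|lborel. ?I t * F' (y + t *\<^sub>R a)) = F (y + a) - F y" for y
  proof -
    have "continuous_on {0..1} (\<lambda>t. F' (y + t *\<^sub>R a))"
      by (intro continuous_on_compose2[OF cont] continuous_intros) auto
    then have "(LINT t|lborel. indicator {0..1} t *\<^sub>R F' (y + t *\<^sub>R a)) = F (y + 1 *\<^sub>R a) - F (y + 0 *\<^sub>R a)"
      by (intro integral_FTC_atLeastAtMost deriv') auto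
    moreover have "indicator {0..1} t *\<^sub>R z = ?I t * z" for t z
      by (simp add: indicator_def)
    ultimately show ?thesis
      by simp
  qed
  have I: "?I = (\<lambda>t. complex_of_real (indicator {0..1} t))"
    by (auto simp: indicator_def)
  have one: "(LINT t|lborel. ?I t) = 1"
    unfolding I integral_complex_of_real by simp
  have intI: "integrable lborel ?I"
    unfolding I by (intro integrable_of_real) simp
  have "(LINT y|lborel. F' y) = (LINT t|lborel. (LINT y|lborel. ?I t * F' (y + t *\<^sub>R a)))"
    by (simp add: lborel_integral_translate one)
  also have "\<dots> = (LINT y|lborel. (LINT t|lborel. ?I t * F' (y + t *\<^sub>R a)))"
    by (intro lborel_pair.Fubini_integral[symmetric] integrable_pair_shear F') (auto intro: intI)
  also have "\<dots> = (LINT y|lborel. F (y + a) - F y)"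
    by (simp only: ftc)
  also have "\<dots> = 0"
    using F by (simp add: lborel_integrable_translate_iff lborel_integral_translate)
  finally show ?thesis .
qed

text \<open>Pure derivatives in a single coordinate direction suffice for all the decay estimates,
  so mixed partial derivatives never have to be commuted.\<close>
definition directional_derivs :: "'n::finite \<Rightarrow> (nat \<Rightarrow> real^'n \<Rightarrow> complex) \<Rightarrow> bool" where
  "directional_derivs i G \<longleftrightarrow> (\<forall>n. continuous_on UNIV (G n) \<and>
     (\<forall>y. ((\<lambda>t. G n (y + t *\<^sub>R axis i 1)) has_vector_derivative G (Suc n) y) (at 0)))"

text \<open>Integration by parts: the derivative of \<open>G n\<close> times the character has
  integral 0, and its two summands yield one factor of the frequency per derivative.\<close>

lemma fourier_directional_deriv:
  fixes G :: "nat \<Rightarrow> real^'n::finite \<Rightarrow> complex"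
  assumes G: "directional_derivs i G" and int: "\<And>n. integrable lborel (G n)"
  shows "fourier (G n) \<xi> = (\<i> * complex_of_real (\<xi> $ i)) ^ n * fourier (G 0) \<xi>"
proof (induction n)
  case (Suc n)
  let ?e = "\<lambda>y::real^'n. exp (- \<i> * complex_of_real (y \<bullet> \<xi>))"
  let ?F' = "\<lambda>y. G (Suc n) y * ?e y + G n y * (- \<i> * complex_of_real (\<xi> $ i) * ?e y)"
  have inte: "integrable lborel (\<lambda>y. G m y * ?e y)" for m
    by (rule Bochner_Integration.integrable_bound[OF int[of m]])
      (use borel_measurable_integrable[OF int[of m]] in \<open>auto simp: norm_mult\<close>)
  have eq: "?F' = (\<lambda>y. G (Suc n) y * ?e y + (- \<i> * complex_of_real (\<xi> $ i)) * (G n y * ?e y))"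
    by (simp add: fun_eq_iff)
  have int': "integrable lborel ?F'"
    unfolding eq by (intro Bochner_Integration.integrable_add integrable_mult_right inte)
  have "(LINT y|lborel. ?F' y) = 0"
  proof (rule integral_partial_derivative_eq_0[OF inte[of n] int'])
    have "continuous_on UNIV (G n)" "continuous_on UNIV (G (Suc n))"
      using G by (auto simp: directional_derivs_def)
    then show "continuous_on UNIV ?F'"
      by (intro continuous_intros) auto
    show "((\<lambda>t. G n (y + t *\<^sub>R axis i 1) * ?e (y + t *\<^sub>R axis i 1)) has_vector_derivative ?F' y) (at 0)" for y
    proof -
      have d1: "((\<lambda>t. G n (y + t *\<^sub>R axis i 1)) has_vector_derivative G (Suc n) y) (at 0)"
        using G by (auto simp: directional_derivs_def)
      have "((\<lambda>t. ?e y * exp (t *\<^sub>R (- \<i> * complex_of_real (\<xi> $ i)))) has_vector_derivative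
          ?e y * (exp (0 *\<^sub>R (- \<i> * complex_of_real (\<xi> $ i))) * (- \<i> * complex_of_real (\<xi> $ i)))) (at 0)"
        by (intro has_vector_derivative_mult_right exp_scaleR_has_vector_derivative_right)
      moreover have "?e y * exp (t *\<^sub>R (- \<i> * complex_of_real (\<xi> $ i))) = ?e (y + t *\<^sub>R axis i 1)" for t
      proof -
        have "(y + t *\<^sub>R axis i 1) \<bullet> \<xi> = y \<bullet> \<xi> + t * \<xi> $ i"
          by (simp add: inner_add_left inner_axis')
        then show ?thesis
          by (simp add: scaleR_conv_of_real exp_add[symmetric] algebra_simps)
      qed
      ultimately have d2: "((\<lambda>t. ?e (y + t *\<^sub>R axis i 1)) has_vector_derivative - \<i> * complex_of_real (\<xi> $ i) * ?e y) (at 0)"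
        by (simp add: mult.commute)
      show ?thesis
        by (rule has_vector_derivative_eq_rhs[OF has_vector_derivative_mult[OF d1 d2]]) simp
    qed
  qed
  then have "(LINT y|lborel. G (Suc n) y * ?e y) = \<i> * complex_of_real (\<xi> $ i) * (LINT y|lborel. G n y * ?e y)"
    unfolding eq using inte by (simp add: Bochner_Integration.integral_add add_eq_0_iff)
  then have "fourier (G (Suc n)) \<xi> = \<i> * complex_of_real (\<xi> $ i) * fourier (G n) \<xi>"
    by (simp add: fourier_def)
  then show ?case
    using Suc by simp
qed simp

lemma norm_fourier_le:
  fixes g :: "real^'n::finite \<Rightarrow> complex"
  assumes "integrable lborel g"
  shows "cmod (fourier g \<xi>) \<le> (LINT y|lborel. cmod (g y))"
proof -
  have "cmod (LINT y|lborel. g y * exp (- \<i> * complex_of_real (y \<bullet> \<xi>))) \<le>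
      (LINT y|lborel. cmod (g y * exp (- \<i> * complex_of_real (y \<bullet> \<xi>))))"
    by (rule integral_norm_bound)
  also have "\<dots> = (LINT y|lborel. cmod (g y))"
    by (simp add: norm_mult)
  finally have le: "cmod (LINT y|lborel. g y * exp (- \<i> * complex_of_real (y \<bullet> \<xi>))) \<le> (LINT y|lborel. cmod (g y))" .
  have "(2 * pi) powr (- real CARD('n) / 2) \<le> (2 * pi) powr 0"
    using pi_ge_two by (intro powr_mono) auto
  then have "(2 * pi) powr (- real CARD('n) / 2) \<le> 1"
    by simp
  then have "(2 * pi) powr (- real CARD('n) / 2) * cmod (LINT y|lborel. g y * exp (- \<i> * complex_of_real (y \<bullet> \<xi>)))
      \<le> 1 * (LINT y|lborel. cmod (g y))"
    by (intro mult_mono le) auto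
  then show ?thesis
    by (simp add: fourier_def norm_mult)
qed

text \<open>Taking the power 1/s turns \<open>fact n powr s\<close> into \<open>fact n\<close>.
  Dividing by 2^n n! and summing over n then gives an exponential on the left and a geometric series
  on the right. The halving causes the rate s/2, and the sum 2 of the series causes the factor 2^s;
  no optimization over n is involved.\<close>

lemma powr_root_bound:
  fixes s r R A v :: real
  assumes s: "s > 0" and r: "r \<ge> 0" and R: "R > 0" and A: "A \<ge> 0" and v: "v \<ge> 0"
    and bound: "\<And>n. r ^ n * v \<le> A * R ^ n * fact n powr s"
  shows "v \<le> A * 2 powr s * exp (- (s / 2) * (r / R) powr (1 / s))"
proof -
  define u where "u = (r / R) powr (1 / s)"
  have u0: "u \<ge> 0" by (simp add: u_def)
  have le: "(u / 2) ^ n / fact n * v powr (1 / s) \<le> A powr (1 / s) * (1 / 2) ^ n" for n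
  proof -
    have "(r / R) ^ n * v \<le> A * fact n powr s"
      using bound[of n] R by (simp add: power_divide field_simps)
    then have "((r / R) ^ n * v) powr (1 / s) \<le> (A * fact n powr s) powr (1 / s)"
      using s r R v by (intro powr_mono2) auto
    moreover have "((r / R) ^ n * v) powr (1 / s) = u ^ n * v powr (1 / s)"
    proof (cases "r = 0")
      case False
      then have pos: "r / R > 0" using r R by simp
      have "((r / R) ^ n * v) powr (1 / s) = ((r / R) ^ n) powr (1 / s) * v powr (1 / s)"
        using pos v by (simp add: powr_mult)
      also have "((r / R) ^ n) powr (1 / s) = u ^ n"
      proof -
        have "u ^ n = u powr real n"
          using r pos by (subst powr_realpow) (auto simp: u_def)
        also have "\<dots> = ((r / R) powr real n) powr (1 / s)"
          by (simp add: u_def powr_powr)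
        also have "(r / R) powr real n = (r / R) ^ n"
          using pos by (simp add: powr_realpow)
        finally show ?thesis ..
      qed
      finally show ?thesis .
    qed (use s v in \<open>auto simp: u_def power_0_left\<close>)
    moreover have "(A * fact n powr s) powr (1 / s) = A powr (1 / s) * fact n"
      using s A by (simp add: powr_mult powr_powr)
    ultimately show ?thesis
      by (simp add: power_divide field_simps)
  qed
  have "(\<lambda>n. (u / 2) ^ n / fact n) sums exp (u / 2)"
  proof -
    have "(\<lambda>n. (u / 2) ^ n / fact n) = (\<lambda>n. (u / 2) ^ n /\<^sub>R fact n)"
      by (rule ext) (simp add: field_simps)
    then show ?thesis by (simp only: exp_converges)
  qed
  then have l: "(\<lambda>n. (u / 2) ^ n / fact n * v powr (1 / s)) sums (exp (u / 2) * v powr (1 / s))"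
    by (rule sums_mult2)
  have "(\<lambda>n. A powr (1 / s) * (1 / 2) ^ n) sums (A powr (1 / s) * (1 / (1 - 1 / 2)))"
    by (intro sums_mult geometric_sums) simp
  from sums_le[OF le l this] have "exp (u / 2) * v powr (1 / s) \<le> 2 * A powr (1 / s)"
    by simp
  then have "(exp (u / 2) * v powr (1 / s)) powr s \<le> (2 * A powr (1 / s)) powr s"
    using s by (intro powr_mono2) auto
  then have "exp (s * u / 2) * v \<le> 2 powr s * A"
    using s A v by (simp add: powr_mult powr_powr exp_powr_real mult.commute)
  then have "v \<le> 2 powr s * A * exp (- (s * u / 2))"
    by (simp add: exp_minus field_simps)
  then show ?thesis
    by (simp add: u_def mult_ac)
qed

text \<open>Taking the largest coordinate allows derivatives in one direction, chosen according to
  the frequency, to control the whole norm at the cost of the dimension as a factor.\<close>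

lemma norm_le_card_mult_component:
  fixes x :: "real^'n::finite"
  shows "\<exists>i. norm x \<le> real CARD('n) * \<bar>x $ i\<bar>"
proof -
  have "Max (range (\<lambda>i. \<bar>x $ i\<bar>)) \<in> range (\<lambda>i. \<bar>x $ i\<bar>)"
    by (rule Max_in) auto
  then obtain i where i: "Max (range (\<lambda>i. \<bar>x $ i\<bar>)) = \<bar>x $ i\<bar>"
    by blast
  have "norm x \<le> (\<Sum>j\<in>UNIV. \<bar>x $ j\<bar>)"
    by (rule norm_le_l1_cart)
  also have "\<dots> \<le> of_nat (card (UNIV::'n set)) * \<bar>x $ i\<bar>"
    by (rule sum_bounded_above) (auto simp flip: i)
  finally show ?thesis by auto
qed

text \<open>\<open>G i n\<close> stands for the n-th derivative of \<open>g\<close> in direction i.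
  The centre \<open>x\<close> of the weight disappears on integration, which later makes the decay
  of the short-time transform uniform in its first variable.\<close>

lemma fourier_decay:
  fixes G :: "'n::finite \<Rightarrow> nat \<Rightarrow> real^'n \<Rightarrow> complex"
  assumes G: "\<And>i. directional_derivs i (G i)" and G0: "\<And>i. G i 0 = g"
    and s: "s > 0" and h: "h > 0" and B: "B \<ge> 0"
    and bound: "\<And>i n y. cmod (G i n y) \<le> B * h ^ n * fact n powr s * decay_weight (y - x)"
  shows "integrable lborel g"
    and "cmod (fourier g \<xi>) \<le> B * (LINT y|lborel. decay_weight (y :: real^'n)) * 2 powr s *
      exp (- (s / 2) * (norm \<xi> / (real CARD('n) * h)) powr (1 / s))"
proof -
  let ?W = "LINT y|lborel. decay_weight (y :: real^'n)"
  have W: "?W \<ge> 0"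
    by (intro integral_nonneg_AE) (auto simp: decay_weight_pos less_imp_le)
  have intw: "integrable lborel (\<lambda>y. C * decay_weight (y - x))" for C
    using lborel_integrable_translate_iff[of decay_weight "- x"] integrable_decay_weight
    by (intro integrable_mult_right) simp
  have int: "integrable lborel (G i n)" for i n
  proof (rule Bochner_Integration.integrable_bound[OF intw[of "B * h ^ n * fact n powr s"]])
    show "G i n \<in> borel_measurable lborel"
      using G[of i] by (simp add: directional_derivs_def borel_measurable_continuous_onI)
    show "AE y in lborel. norm (G i n y) \<le> norm (B * h ^ n * fact n powr s * decay_weight (y - x))"
      using bound by (intro AE_I2) (auto intro: order_trans[OF _ abs_ge_self])
  qed
  show "integrable lborel g"
    using int[of _ 0] G0 by simp
  obtain i where i: "norm \<xi> \<le> real CARD('n) * \<bar>\<xi> $ i\<bar>"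
    using norm_le_card_mult_component by blast
  have "(norm \<xi>) ^ n * cmod (fourier g \<xi>) \<le> (B * ?W) * (real CARD('n) * h) ^ n * fact n powr s" for n
  proof -
    have "(norm \<xi>) ^ n * cmod (fourier g \<xi>) \<le> (real CARD('n) * \<bar>\<xi> $ i\<bar>) ^ n * cmod (fourier g \<xi>)"
      by (intro mult_right_mono power_mono i) auto
    also have "\<dots> = real CARD('n) ^ n * cmod (fourier (G i n) \<xi>)"
      by (simp add: fourier_directional_deriv[OF G int] G0 norm_mult norm_power power_mult_distrib)
    also have "cmod (fourier (G i n) \<xi>) \<le> (LINT y|lborel. cmod (G i n y))"
      by (rule norm_fourier_le[OF int])
    also have "\<dots> \<le> (LINT y|lborel. B * h ^ n * fact n powr s * decay_weight (y - x))"
      by (intro integral_mono integrable_norm int intw bound)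
    also have "\<dots> = B * h ^ n * fact n powr s * ?W"
      using lborel_integral_translate[of decay_weight "- x"] by simp
    finally show ?thesis
      by (simp add: power_mult_distrib mult_ac mult_left_mono)
  qed
  then show "cmod (fourier g \<xi>) \<le> B * ?W * 2 powr s *
      exp (- (s / 2) * (norm \<xi> / (real CARD('n) * h)) powr (1 / s))"
    using s h B W by (intro powr_root_bound) auto
qed

lemma directional_derivs_mult:
  assumes u: "directional_derivs i u" and v: "directional_derivs i v"
  shows "directional_derivs i (\<lambda>n y. \<Sum>k\<le>n. of_nat (n choose k) * u k y * v (n - k) y)"
  unfolding directional_derivs_def
proof (intro allI conjI)
  fix n
  have cont: "continuous_on UNIV (u k)" "continuous_on UNIV (v k)" for k
    using u v by (auto simp: directional_derivs_def)
  show "continuous_on UNIV (\<lambda>y. \<Sum>k\<le>n. of_nat (n choose k) * u k y * v (n - k) y)"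
    by (intro continuous_intros cont)
  fix y
  have du: "((\<lambda>t. u k (y + t *\<^sub>R axis i 1)) has_vector_derivative u (Suc k) y) (at 0)"
    and dv: "((\<lambda>t. v k (y + t *\<^sub>R axis i 1)) has_vector_derivative v (Suc k) y) (at 0)" for k
    using u v by (auto simp: directional_derivs_def)
  have d: "((\<lambda>t. of_nat (n choose k) * u k (y + t *\<^sub>R axis i 1) * v (n - k) (y + t *\<^sub>R axis i 1)) has_vector_derivative
     of_nat (n choose k) * u k y * v (Suc n - k) y + of_nat (n choose k) * u (Suc k) y * v (n - k) y) (at 0)"
    if "k \<le> n" for k
  proof -
    have "((\<lambda>t. of_nat (n choose k) * (u k (y + t *\<^sub>R axis i 1) * v (n - k) (y + t *\<^sub>R axis i 1))) has_vector_derivative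
     of_nat (n choose k) * (u k (y + 0 *\<^sub>R axis i 1) * v (Suc (n - k)) y + u (Suc k) y * v (n - k) (y + 0 *\<^sub>R axis i 1))) (at 0)"
      by (intro has_vector_derivative_mult_right has_vector_derivative_mult du dv)
    then show ?thesis
      using that by (simp add: algebra_simps Suc_diff_le)
  qed
  have "((\<lambda>t. \<Sum>k\<le>n. of_nat (n choose k) * u k (y + t *\<^sub>R axis i 1) * v (n - k) (y + t *\<^sub>R axis i 1)) has_vector_derivative
     (\<Sum>k\<le>n. of_nat (n choose k) * u k y * v (Suc n - k) y + of_nat (n choose k) * u (Suc k) y * v (n - k) y)) (at 0)"
    by (intro has_vector_derivative_sum d) auto
  also have "(\<Sum>k\<le>n. of_nat (n choose k) * u k y * v (Suc n - k) y + of_nat (n choose k) * u (Suc k) y * v (n - k) y)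
     = (\<Sum>k\<le>Suc n. of_nat (Suc n choose k) * u k y * v (Suc n - k) y)"
  proof -
    have "(\<Sum>k\<le>Suc n. of_nat (Suc n choose k) * u k y * v (Suc n - k) y)
       = u 0 y * v (Suc n) y + (\<Sum>k\<le>n. of_nat (n choose Suc k) * u (Suc k) y * v (n - k) y)
         + (\<Sum>k\<le>n. of_nat (n choose k) * u (Suc k) y * v (n - k) y)"
      by (simp add: sum.atMost_Suc_shift sum.distrib algebra_simps del: sum.atMost_Suc)
    also have "u 0 y * v (Suc n) y + (\<Sum>k\<le>n. of_nat (n choose Suc k) * u (Suc k) y * v (n - k) y)
       = (\<Sum>k\<le>Suc n. of_nat (n choose k) * u k y * v (Suc n - k) y)"
      by (simp add: sum.atMost_Suc_shift del: sum.atMost_Suc)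
    \<comment> \<open>The top term vanishes because \<open>n choose Suc n\<close> is 0.\<close>
    also have "\<dots> = (\<Sum>k\<le>n. of_nat (n choose k) * u k y * v (Suc n - k) y)"
      by simp
    finally show ?thesis
      by (simp add: sum.distrib)
  qed
  finally show "((\<lambda>t. \<Sum>k\<le>n. of_nat (n choose k) * u k (y + t *\<^sub>R axis i 1) * v (n - k) (y + t *\<^sub>R axis i 1)) has_vector_derivative
     (\<Sum>k\<le>Suc n. of_nat (Suc n choose k) * u k y * v (Suc n - k) y)) (at 0)" .
qed

text \<open>Since k! (n-k)! is at most n!, the factorials of the two factors are absorbed by that of
  the product, and the binomial theorem adds the radii.\<close>

lemma norm_leibniz_le:
  fixes u v :: "nat \<Rightarrow> complex"
  assumes u: "\<And>k. cmod (u k) \<le> A * a ^ k * fact k powr s" and v: "\<And>k. cmod (v k) \<le> B * b ^ k * fact k powr s"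
    and nonneg: "A \<ge> 0" "a \<ge> 0" "B \<ge> 0" "b \<ge> 0" and s: "s \<ge> 0"
  shows "cmod (\<Sum>k\<le>n. of_nat (n choose k) * u k * v (n - k)) \<le> A * B * (a + b) ^ n * fact n powr s"
proof -
  have "cmod (of_nat (n choose k) * u k * v (n - k)) \<le>
      A * B * fact n powr s * (of_nat (n choose k) * a ^ k * b ^ (n - k))" if "k \<le> n" for k
  proof -
    have "fact k powr s * fact (n - k) powr s = (fact k * fact (n - k)) powr s"
      by (simp add: powr_mult)
    also have "\<dots> \<le> fact n powr s"
    proof (rule powr_mono2)
      have "fact k * fact (n - k) \<le> (fact n :: nat)"
        using fact_fact_dvd_fact[of k "n - k"] that by (intro dvd_imp_le) (auto simp: fact_fact_dvd_fact)
      then show "fact k * fact (n - k) \<le> (fact n :: real)"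
        by (metis of_nat_fact of_nat_le_iff of_nat_mult)
    qed (use s in auto)
    finally have f: "fact k powr s * fact (n - k) powr s \<le> fact n powr s" .
    have "cmod (of_nat (n choose k) * u k * v (n - k)) \<le>
        of_nat (n choose k) * (A * a ^ k * fact k powr s) * (B * b ^ (n - k) * fact (n - k) powr s)"
      unfolding norm_mult norm_of_nat using nonneg
      by (intro mult_mono u v mult_nonneg_nonneg order_refl) auto
    also have "\<dots> = (A * B * (of_nat (n choose k) * a ^ k * b ^ (n - k))) * (fact k powr s * fact (n - k) powr s)"
      by (simp add: mult_ac)
    also have "\<dots> \<le> (A * B * (of_nat (n choose k) * a ^ k * b ^ (n - k))) * fact n powr s"
      using nonneg by (intro mult_left_mono f) auto
    finally show ?thesis by (simp add: mult_ac)
  qed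
  then have "cmod (\<Sum>k\<le>n. of_nat (n choose k) * u k * v (n - k)) \<le>
      (\<Sum>k\<le>n. A * B * fact n powr s * (of_nat (n choose k) * a ^ k * b ^ (n - k)))"
    by (intro sum_norm_le) auto
  also have "\<dots> = A * B * (a + b) ^ n * fact n powr s"
    by (simp add: binomial_ring sum_distrib_left mult_ac)
  finally show ?thesis .
qed

section \<open>Gevrey and Gelfand-Shilov bounds\<close>

lemma smooth_directional_derivs:
  assumes "smooth f"
  shows "directional_derivs i (\<lambda>n. pderivs (replicate n i) f)"
  unfolding directional_derivs_def
proof (intro allI conjI)
  fix n y
  show "continuous_on UNIV (pderivs (replicate n i) f)"
    using assms by (auto simp: smooth_def)
  have "(\<lambda>t. pderivs (replicate n i) f (y + t *\<^sub>R axis i 1)) differentiable (at 0)"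
    using assms by (auto simp: smooth_def)
  then show "((\<lambda>t. pderivs (replicate n i) f (y + t *\<^sub>R axis i 1)) has_vector_derivative
      pderivs (replicate (Suc n) i) f y) (at 0)"
    by (simp add: partial_def vector_derivative_works)
qed

text \<open>A multi-index supported at one coordinate is represented by a single list of directions,
  so the choice operator in \<open>dmi\<close> has no freedom here.\<close>

lemma dmi_single: "dmi (\<lambda>j. if j = i then n else 0) f = pderivs (replicate n i) f"
proof -
  have count: "count_list (replicate n i) j = (if j = i then n else 0)" for n j
    by (induction n) auto
  have "xs = replicate n i" if "\<forall>j. count_list xs j = (if j = i then n else 0)" for xs
  proof -
    have "set xs \<subseteq> {i}"
      using that by (metis count_list_0_iff insertI1 subsetI)
    then have "xs = replicate (length xs) i"
      by (intro replicate_length_same[symmetric]) auto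
    moreover from this have "length xs = n"
      using that by (metis count)
    ultimately show ?thesis by simp
  qed
  then have "(SOME xs. \<forall>j. count_list xs j = (if j = i then n else 0)) = replicate n i"
    by (intro some_equality) (auto simp: count)
  then show ?thesis
    by (simp add: dmi_def)
qed

lemma mi_abs_single: "mi_abs (\<lambda>j. if j = (i::'n::finite) then n else 0) = n"
  by (simp add: mi_abs_def)

lemma mi_fact_single: "mi_fact (\<lambda>j. if j = (i::'n::finite) then n else 0) = fact n"
proof -
  have "(\<Prod>j\<in>UNIV. fact (if j = i then n else 0)) = (\<Prod>j\<in>UNIV. if j = i then fact n else (1::real))"
    by (rule prod.cong) auto
  then show ?thesis
    by (simp add: mi_fact_def)
qed

lemma pderivs_periodic:
  assumes "periodic_on_lattice e f"
  shows "periodic_on_lattice e (pderivs xs f)"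
proof (induction xs)
  case Nil
  then show ?case using assms by simp
next
  case (Cons i xs)
  have "pderivs xs f (x + l + t *\<^sub>R axis i 1) = pderivs xs f (x + t *\<^sub>R axis i 1)"
    if "l \<in> lattice e" for x l t
  proof -
    have "x + l + t *\<^sub>R axis i 1 = (x + t *\<^sub>R axis i 1) + l"
      by simp
    then show ?thesis
      using Cons that by (simp only: periodic_on_lattice_def)
  qed
  then show ?case
    by (simp add: periodic_on_lattice_def partial_def)
qed

lemma directional_derivs_cnj_translate:
  assumes "directional_derivs i v"
  shows "directional_derivs i (\<lambda>n y. cnj (v n (y - x)))"
  unfolding directional_derivs_def
proof (intro allI conjI)
  fix n
  have "continuous_on UNIV (v n)"
    using assms by (auto simp: directional_derivs_def)
  then have "continuous_on UNIV (\<lambda>y. v n (y - x))"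
    by (rule continuous_on_compose2) (auto intro!: continuous_intros)
  then show "continuous_on UNIV (\<lambda>y. cnj (v n (y - x)))"
    by (rule continuous_on_cnj)
  fix y
  have "((\<lambda>t. v n ((y - x) + t *\<^sub>R axis i 1)) has_vector_derivative v (Suc n) (y - x)) (at 0)"
    using assms by (auto simp: directional_derivs_def)
  then show "((\<lambda>t. cnj (v n (y + t *\<^sub>R axis i 1 - x))) has_vector_derivative cnj (v (Suc n) (y - x))) (at 0)"
    by (intro has_vector_derivative_cnj) (simp add: algebra_simps)
qed

text \<open>Adding the seminorm bounds for the finitely many \<beta> with entries 0 and 2, at the
  pure derivative of order n in direction i, produces the reciprocal weight on the left and a
  constant independent of n and i on the right.\<close>

lemma GS_directional_bound:
  fixes \<phi> :: "real^'n::finite \<Rightarrow> complex"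
  assumes "\<And>\<alpha> \<beta> x. cmod (of_real (mi_pow x \<beta>) * dmi \<alpha> \<phi> x)
        \<le> C * h ^ (mi_abs \<alpha> + mi_abs \<beta>) * mi_fact \<alpha> powr s * mi_fact \<beta> powr t"
  obtains B where "B \<ge> 0"
    "\<And>i n y. cmod (pderivs (replicate n i) \<phi> y) \<le> B * h ^ n * fact n powr s * decay_weight y"
proof -
  let ?\<beta> = "\<lambda>(S::'n set) j. if j \<in> S then 2 else 0 :: nat"
  define B where "B = (\<Sum>S\<in>Pow (UNIV::'n set). C * h ^ mi_abs (?\<beta> S) * mi_fact (?\<beta> S) powr t)"
  have bound: "cmod (pderivs (replicate n i) \<phi> y) \<le> B * h ^ n * fact n powr s * decay_weight y" for i n y
  proof -
    have "inverse (decay_weight y) * cmod (pderivs (replicate n i) \<phi> y) =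
        (\<Sum>S\<in>Pow UNIV. cmod (of_real (mi_pow y (?\<beta> S)) * dmi (\<lambda>j. if j = i then n else 0) \<phi> y))"
    proof -
      have "mi_pow y (?\<beta> S) \<ge> 0" for S
        unfolding mi_pow_def by (intro prod_nonneg) auto
      then show ?thesis
        by (simp add: inverse_decay_weight sum_distrib_right dmi_single norm_mult)
    qed
    also have "\<dots> \<le> (\<Sum>S\<in>Pow UNIV. C * h ^ (n + mi_abs (?\<beta> S)) * fact n powr s * mi_fact (?\<beta> S) powr t)"
    proof (rule sum_mono)
      fix S
      show "cmod (of_real (mi_pow y (?\<beta> S)) * dmi (\<lambda>j. if j = i then n else 0) \<phi> y)
          \<le> C * h ^ (n + mi_abs (?\<beta> S)) * fact n powr s * mi_fact (?\<beta> S) powr t"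
        using assms[where x = y and \<beta> = "?\<beta> S" and \<alpha> = "\<lambda>j. if j = i then n else 0"]
        by (simp add: mi_abs_single mi_fact_single)
    qed
    also have "\<dots> = B * h ^ n * fact n powr s"
      unfolding B_def sum_distrib_right by (rule sum.cong) (auto simp: power_add)
    finally show ?thesis
      using decay_weight_pos[of y] by (simp add: field_simps)
  qed
  \<comment> \<open>The sign of \<open>C\<close> is unknown, so that of \<open>B\<close> is read off
    from the bound itself at n = 0 and y = 0.\<close>
  have "0 \<le> B * decay_weight (0::real^'n)"
    using bound[of 0 undefined 0] by (simp add: order_trans[OF norm_ge_zero])
  then have "B \<ge> 0"
    using decay_weight_pos[of "0::real^'n"] by (simp add: zero_le_mult_iff)
  then show ?thesis
    using bound that by blast
qed

text \<open>In the product of \<psi> and the shifted window all spatial decay comes from the window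
  and is centred at \<open>x\<close>, while both factors contribute to the Gevrey radius a +
  b.\<close>

lemma stft_decay:
  fixes \<phi> \<psi> :: "real^'n::finite \<Rightarrow> complex"
  assumes \<phi>: "smooth \<phi>" and \<psi>: "smooth \<psi>"
    and \<phi>_bound: "\<And>i n y. cmod (pderivs (replicate n i) \<phi> y) \<le> B * b ^ n * fact n powr s * decay_weight y"
    and \<psi>_bound: "\<And>i n y. cmod (pderivs (replicate n i) \<psi> y) \<le> A * a ^ n * fact n powr s"
    and nonneg: "A \<ge> 0" "B \<ge> 0" "a > 0" "b > 0" and s: "s > 0"
  shows "cmod (stft \<phi> \<psi> x \<xi>) \<le> A * B * (LINT y|lborel. decay_weight (y :: real^'n)) * 2 powr s *
      exp (- (s / 2) * (norm \<xi> / (real CARD('n) * (a + b))) powr (1 / s))"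
  unfolding stft_def
proof (rule fourier_decay(2)[where x = x])
  let ?G = "\<lambda>i n y. \<Sum>k\<le>n. of_nat (n choose k) * pderivs (replicate k i) \<psi> y *
    cnj (pderivs (replicate (n - k) i) \<phi> (y - x))"
  show "directional_derivs i (?G i)" for i
    by (intro directional_derivs_mult smooth_directional_derivs \<psi>
        directional_derivs_cnj_translate[OF smooth_directional_derivs[OF \<phi>]])
  show "?G i 0 = (\<lambda>y. \<psi> y * cnj (\<phi> (y - x)))" for i
    by simp
  show "cmod (?G i n y) \<le> A * B * (a + b) ^ n * fact n powr s * decay_weight (y - x)" for i n y
  proof -
    have "cmod (?G i n y) \<le> A * (B * decay_weight (y - x)) * (a + b) ^ n * fact n powr s"
      using \<phi>_bound[where y = "y - x"] \<psi>_bound[where y = y] nonneg s decay_weight_pos[of "y - x"]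
      by (intro norm_leibniz_le) (auto simp: mult_ac)
    then show ?thesis by (simp add: mult_ac)
  qed
qed (use nonneg s in auto)

lemma window_fourier_decay:
  fixes \<phi> :: "real^'n::finite \<Rightarrow> complex"
  assumes \<phi>: "smooth \<phi>"
    and \<phi>_bound: "\<And>i n y. cmod (pderivs (replicate n i) \<phi> y) \<le> B * b ^ n * fact n powr s * decay_weight y"
    and nonneg: "B \<ge> 0" "b > 0" and s: "s > 0"
  shows "cmod (fourier \<phi> \<xi>) \<le> B * (LINT y|lborel. decay_weight (y :: real^'n)) * 2 powr s *
      exp (- (s / 2) * (norm \<xi> / (real CARD('n) * b)) powr (1 / s))"
  by (rule fourier_decay(2)[where x = 0 and G = "\<lambda>i n. pderivs (replicate n i) \<phi>"])
    (use assms smooth_directional_derivs in auto)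

section \<open>Integrals of periodic functions\<close>

locale lattice_basis =
  fixes e :: "'n::finite \<Rightarrow> real^'n"
  assumes independent: "independent (range e)" and inj: "inj e"
begin

text \<open>The change of coordinates that carries the unit cube onto \<open>para e\<close> and
  integer vectors onto the lattice.\<close>

definition comb :: "real^'n \<Rightarrow> real^'n" where
  "comb u = (\<Sum>k\<in>UNIV. u $ k *\<^sub>R e k)"

lemma linear_comb: "linear comb"
  unfolding comb_def
  by (intro linearI) (simp_all add: scaleR_add_left sum.distrib scaleR_sum_right)

lemma inj_comb: "inj comb"
proof (subst linear_injective_0[OF linear_comb], intro allI impI)
  fix u assume "comb u = 0"
  then have "(\<Sum>v\<in>range e. (u $ inv e v) *\<^sub>R v) = 0"
    unfolding comb_def by (subst sum.reindex[OF inj]) (simp add: inv_f_f[OF inj])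
  then have "u $ inv e v = 0" if "v \<in> range e" for v
    by (rule independentD[OF independent, rotated 2]) (use that in auto)
  then have "u $ k = 0" for k
    by (metis inv_f_f[OF inj] rangeI)
  then show "u = 0"
    by (simp add: vec_eq_iff)
qed

lemma bij_comb: "bij comb"
  using inj_comb linear_injective_imp_surjective[OF linear_comb inj_comb] by (simp add: bij_def)

definition coords :: "real^'n \<Rightarrow> real^'n" where
  "coords = inv comb"

lemma comb_coords [simp]: "comb (coords y) = y"
  using bij_comb by (simp add: coords_def bij_is_surj surj_f_inv_f)

lemma coords_comb [simp]: "coords (comb u) = u"
  by (simp add: coords_def inv_f_f[OF inj_comb])

lemma linear_coords: "linear coords"
  using linear_comb bij_comb unfolding coords_def by (simp add: inj_linear_imp_inv_linear bij_is_inj)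

lemma continuous_coords: "continuous_on S coords"
  using linear_coords by (simp add: linear_continuous_on linear_conv_bounded_linear)

lemma coords_basis: "coords (e k) = axis k 1"
proof -
  have "comb (axis k 1) = (\<Sum>j\<in>UNIV. if j = k then e j else 0)"
    unfolding comb_def by (rule sum.cong) (auto simp: axis_def)
  then have "comb (axis k 1) = e k" by simp
  then show ?thesis by (metis coords_comb)
qed

lemma coords_add_basis: "coords (y + t *\<^sub>R e k) $ j = coords y $ j + (if j = k then t else 0)"
  using linear_coords by (simp add: linear_add linear_scale coords_basis axis_def)

lemma para_eq: "para e = comb ` cbox 0 1"
proof -
  have "comb (\<chi> k. u k) = (\<Sum>k\<in>UNIV. u k *\<^sub>R e k)" for u
    by (simp add: comb_def)
  then have "para e = {comb (\<chi> k. u k) |u. \<forall>k. 0 \<le> u k \<and> u k \<le> 1}"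
    by (simp add: para_def)
  also have "\<dots> = comb ` cbox 0 1"
  proof (intro subset_antisym subsetI)
    fix y assume "y \<in> comb ` cbox 0 1"
    then obtain v where v: "v \<in> cbox 0 1" "y = comb v" by auto
    then have "y = comb (\<chi> k. v $ k)" "\<forall>k. 0 \<le> v $ k \<and> v $ k \<le> 1"
      by (auto simp: mem_box_cart)
    then show "y \<in> {comb (\<chi> k. u k) |u. \<forall>k. 0 \<le> u k \<and> u k \<le> 1}"
      by blast
  qed (auto simp: mem_box_cart)
  finally show ?thesis .
qed

lemma compact_para: "compact (para e)"
  unfolding para_eq by (intro compact_continuous_image linear_continuous_on compact_cbox)
    (use linear_comb in \<open>simp add: linear_conv_bounded_linear\<close>)

lemma sets_para [measurable]: "para e \<in> sets borel"
  using compact_para by (intro borel_closed compact_imp_closed)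

text \<open>The half-open fundamental domain. Its lattice translates are disjoint, so translation
  arguments become exact identities of indicators instead of identities up to faces.\<close>

definition cell :: "(real^'n) set" where
  "cell = {y. \<forall>k. 0 \<le> coords y $ k \<and> coords y $ k < 1}"

lemma sets_cell [measurable]: "cell \<in> sets borel"
proof -
  have [measurable]: "(\<lambda>y. coords y $ k) \<in> borel_measurable borel" for k
    by (intro borel_measurable_continuous_onI continuous_intros continuous_coords)
  have "cell = (\<Inter>k\<in>UNIV. {y. 0 \<le> coords y $ k \<and> coords y $ k < 1})"
    by (auto simp: cell_def)
  also have "\<dots> \<in> sets borel"
    by (intro sets.finite_INT) auto
  finally show ?thesis .
qed

lemma cell_subset_para: "cell \<subseteq> para e"
proof
  fix y assume "y \<in> cell"
  then have "coords y \<in> cbox 0 1" by (auto simp: cell_def mem_box_cart less_imp_le)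
  then show "y \<in> para e" unfolding para_eq by (metis comb_coords image_eqI)
qed

text \<open>The difference lies in the linear image of the boundary of the cube, and linear maps
  preserve negligible sets.\<close>

lemma null_para_minus_cell: "para e - cell \<in> null_sets lborel"
proof -
  have "para e - cell \<subseteq> comb ` (cbox 0 1 - box 0 1)"
  proof
    fix y assume y: "y \<in> para e - cell"
    then obtain u where u: "u \<in> cbox 0 1" "y = comb u" by (auto simp: para_eq)
    then have "u \<notin> box 0 1" using y by (auto simp: cell_def mem_box_cart less_imp_le)
    then show "y \<in> comb ` (cbox 0 1 - box 0 1)" using u by auto
  qed
  moreover have "negligible (comb ` (cbox 0 1 - box 0 1))"
    using linear_comb
    by (intro negligible_differentiable_image_negligible negligible_frontier_interval linear_imp_differentiable_on) auto
  ultimately have "negligible (para e - cell)"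
    by (rule negligible_subset[rotated])
  then show ?thesis
    by (auto simp: negligible_iff_null_sets null_sets_completion_iff)
qed

text \<open>The image of the open cube is open and nonempty, hence not negligible. Positivity is
  used to cancel the factor 1/|E| in \<open>fcoeff\<close>.\<close>

lemma measure_para_pos: "measure lborel (para e) > 0"
proof (rule ccontr)
  assume "\<not> measure lborel (para e) > 0"
  then have "measure lborel (para e) = 0"
    by (simp add: zero_less_measure_iff)
  moreover have "emeasure lborel (para e) < \<infinity>"
    using compact_para by (rule emeasure_compact_finite)
  ultimately have "para e \<in> null_sets lborel"
    by (auto simp: emeasure_eq_ennreal_measure)
  then have "negligible (para e)"
    by (simp add: negligible_iff_null_sets null_sets_completionI)
  moreover have "comb ` box 0 1 \<subseteq> para e"
    unfolding para_eq using box_subset_cbox by blast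
  ultimately have "negligible (comb ` box 0 1)"
    by (rule negligible_subset)
  moreover have "open (comb ` box 0 1)"
    using linear_comb bij_comb by (intro open_surjective_linear_image) (auto simp: bij_is_surj)
  moreover have "comb ` box 0 1 \<noteq> {}"
    by (simp add: interval_ne_empty_cart)
  ultimately show False
    by (simp add: open_not_negligible)
qed

lemma lattice_decomposition: "\<exists>l\<in>lattice e. x + l \<in> para e"
proof -
  define m where "m k = - \<lfloor>coords x $ k\<rfloor>" for k
  define l where "l = (\<Sum>k\<in>UNIV. real_of_int (m k) *\<^sub>R e k)"
  have "l = comb (\<chi> k. real_of_int (m k))"
    by (simp add: l_def comb_def)
  then have "coords (x + l) $ k = coords x $ k - real_of_int \<lfloor>coords x $ k\<rfloor>" for k
    using linear_coords by (simp add: linear_add m_def)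
  then have "x + l \<in> cell"
    by (simp add: cell_def) linarith
  moreover have "l \<in> lattice e"
    by (auto simp: lattice_def l_def)
  ultimately show ?thesis
    using cell_subset_para by blast
qed

text \<open>Every point has a lattice translate in the parallelepiped; this extends local Gevrey
  bounds on one compact set to the whole space.\<close>

lemma periodic_para_bound:
  assumes "periodic_on_lattice e f" and "\<And>x. x \<in> para e \<Longrightarrow> cmod (f x) \<le> C"
  shows "cmod (f x) \<le> C"
  using assms lattice_decomposition[of x] by (metis periodic_on_lattice_def)

lemma integrable_on_bounded:
  fixes g :: "real^'n \<Rightarrow> complex"
  assumes g: "continuous_on UNIV g" and S: "S \<in> sets borel" "S \<subseteq> K" "compact K"
  shows "integrable lborel (\<lambda>x. indicator S x * g x)"
proof -
  have "integrable lborel (\<lambda>x. indicator K x *\<^sub>R g x)"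
    using borel_integrable_compact[OF \<open>compact K\<close>, of g] continuous_on_subset[OF g] by auto
  then show ?thesis
    by (rule Bochner_Integration.integrable_bound)
      (use S borel_measurable_continuous_onI[OF g] in \<open>auto simp: indicator_def\<close>)
qed

text \<open>Translating the half-open cell by \<open>t\<close> along \<open>e k\<close> with \<open>0 \<le> t < 1\<close> moves exactly the slab
  where the \<open>k\<close>-th coordinate is less than \<open>t\<close> out of it, and that slab re-enters after a shift by \<open>- e k\<close>.\<close>
lemma cell_integral_translate_frac:
  fixes g :: "real^'n \<Rightarrow> complex"
  assumes g: "continuous_on UNIV g" and per: "\<And>x. g (x + e k) = g x" and t: "0 \<le> t" "t < 1"
  shows "(LINT x|lborel. indicator cell x * g (x + t *\<^sub>R e k)) = (LINT x|lborel. indicator cell x * g x)"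
proof -
  have per': "g (x - e k) = g x" for x
    using per[of "x - e k"] by simp
  let ?A = "{y \<in> cell. coords y $ k \<ge> t}" and ?B = "{y \<in> cell. coords y $ k < t}"
  have [measurable]: "(\<lambda>y. coords y $ k) \<in> borel_measurable borel"
    by (intro borel_measurable_continuous_onI continuous_intros continuous_coords)
  have AB: "?A \<in> sets borel" "?B \<in> sets borel"
    by measurable
  have iA: "integrable lborel (\<lambda>x. indicator ?A x * g x)" and iB: "integrable lborel (\<lambda>x. indicator ?B x * g x)"
    by (rule integrable_on_bounded[OF g _ _ compact_para]; use AB cell_subset_para in auto)+
  have split: "(indicator cell (x - t *\<^sub>R e k) :: complex) = indicator ?A x + indicator ?B (x - e k)" for x
  proof -
    have c1: "coords (x - t *\<^sub>R e k) $ j = coords x $ j - (if j = k then t else 0)" for j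
      using coords_add_basis[of x "- t" k j] by simp
    have c2: "coords (x - e k) $ j = coords x $ j - (if j = k then 1 else 0)" for j
      using coords_add_basis[of x "- 1" k j] by simp
    have "x - t *\<^sub>R e k \<in> cell \<longleftrightarrow> x \<in> ?A \<or> x - e k \<in> ?B"
    proof -
      let ?c = "coords x $ k"
      \<comment> \<open>\<open>Q\<close> collects the conditions on the coordinates other than k,
        which the shifts along \<open>e k\<close> leave alone; what remains concerns one real
        number.\<close>
      define Q where "Q \<longleftrightarrow> (\<forall>j. j \<noteq> k \<longrightarrow> 0 \<le> coords x $ j \<and> coords x $ j < 1)"
      have others: "(\<forall>j. 0 \<le> coords x $ j - (if j = k then a else 0) \<and> coords x $ j - (if j = k then a else 0) < 1)
          \<longleftrightarrow> Q \<and> a \<le> ?c \<and> ?c < 1 + a" for a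
        by (auto simp: Q_def)
      have "x - t *\<^sub>R e k \<in> cell \<longleftrightarrow> Q \<and> t \<le> ?c \<and> ?c < 1 + t"
        unfolding cell_def mem_Collect_eq c1 others ..
      moreover have "x - e k \<in> cell \<longleftrightarrow> Q \<and> 1 \<le> ?c \<and> ?c < 2"
        unfolding cell_def mem_Collect_eq c2 others by simp
      moreover have "x \<in> cell \<longleftrightarrow> Q \<and> 0 \<le> ?c \<and> ?c < 1"
        using others[of 0] by (simp add: cell_def)
      ultimately show ?thesis
        using c2[of k] t by auto
    qed
    moreover have "\<not> (x \<in> ?A \<and> x - e k \<in> ?B)"
    proof
      assume "x \<in> ?A \<and> x - e k \<in> ?B"
      then have "coords x $ k < 1" "0 \<le> coords (x - e k) $ k"
        by (auto simp: cell_def)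
      then show False
        using c2[of k] by simp
    qed
    ultimately show ?thesis
      by (auto simp: indicator_def)
  qed
  have iB': "integrable lborel (\<lambda>x. indicator ?B (x - e k) * g x)"
    using lborel_integrable_translate_iff[of "\<lambda>x. indicator ?B x * g x" "- e k"] iB by (simp add: per')
  have "(LINT x|lborel. indicator cell x * g (x + t *\<^sub>R e k)) = (LINT x|lborel. indicator cell (x - t *\<^sub>R e k) * g x)"
    using lborel_integral_translate[of "\<lambda>x. indicator cell x * g (x + t *\<^sub>R e k)" "- t *\<^sub>R e k"] by simp
  also have "\<dots> = (LINT x|lborel. indicator ?A x * g x + indicator ?B (x - e k) * g x)"
    by (simp only: split distrib_right)
  also have "\<dots> = (LINT x|lborel. indicator ?A x * g x) + (LINT x|lborel. indicator ?B (x - e k) * g x)"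
    by (rule Bochner_Integration.integral_add[OF iA iB'])
  also have "(LINT x|lborel. indicator ?B (x - e k) * g x) = (LINT x|lborel. indicator ?B x * g x)"
    using lborel_integral_translate[of "\<lambda>x. indicator ?B x * g x" "- e k"] by (simp add: per')
  also have "(LINT x|lborel. indicator ?A x * g x) + \<dots> = (LINT x|lborel. indicator ?A x * g x + indicator ?B x * g x)"
    by (rule Bochner_Integration.integral_add[OF iA iB, symmetric])
  also have "\<dots> = (LINT x|lborel. indicator cell x * g x)"
    by (rule Bochner_Integration.integral_cong) (auto simp: indicator_def)
  finally show ?thesis .
qed

lemma int_scaleR_basis_in_lattice: "real_of_int z *\<^sub>R e k \<in> lattice e"
proof -
  have "(\<Sum>j\<in>UNIV. real_of_int (if j = k then z else 0) *\<^sub>R e j) = (\<Sum>j\<in>UNIV. if j = k then real_of_int z *\<^sub>R e j else 0)"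
    by (rule sum.cong) auto
  also have "\<dots> = real_of_int z *\<^sub>R e k"
    by simp
  finally have eq: "(\<Sum>j\<in>UNIV. real_of_int (if j = k then z else 0) *\<^sub>R e j) = real_of_int z *\<^sub>R e k" .
  show ?thesis
    unfolding lattice_def mem_Collect_eq
    by (intro exI[of _ "\<lambda>j. if j = k then z else 0"] conjI TrueI) (rule eq[symmetric])
qed

text \<open>The integer part of \<open>t\<close> moves by a lattice vector and is invisible to the
  periodic \<open>g\<close>, so only the fractional part has to be treated.\<close>

lemma cell_integral_translate_basis:
  fixes g :: "real^'n \<Rightarrow> complex"
  assumes g: "continuous_on UNIV g" and per: "periodic_on_lattice e g"
  shows "(LINT x|lborel. indicator cell x * g (x + t *\<^sub>R e k)) = (LINT x|lborel. indicator cell x * g x)"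
proof -
  have "g (x + t *\<^sub>R e k) = g (x + frac t *\<^sub>R e k)" for x
  proof -
    have "x + t *\<^sub>R e k = (x + frac t *\<^sub>R e k) + real_of_int \<lfloor>t\<rfloor> *\<^sub>R e k"
      by (simp add: frac_def algebra_simps)
    then show ?thesis
      using per int_scaleR_basis_in_lattice unfolding periodic_on_lattice_def by metis
  qed
  moreover have "g (x + e k) = g x" for x
    using per int_scaleR_basis_in_lattice[of 1 k] by (simp add: periodic_on_lattice_def)
  ultimately show ?thesis
    using cell_integral_translate_frac[OF g, of k "frac t"] by (simp add: frac_ge_0 frac_lt_1)
qed

lemma para_integral_eq_cell:
  fixes g :: "real^'n \<Rightarrow> complex"
  assumes "g \<in> borel_measurable borel"
  shows "(LINT x:para e|lborel. g x) = (LINT x|lborel. indicator cell x * g x)"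
proof -
  have "AE x in lborel. x \<notin> para e - cell"
    using null_para_minus_cell by (rule AE_not_in)
  then have "AE x in lborel. indicator (para e) x *\<^sub>R g x = indicator cell x * g x"
    by eventually_elim (use cell_subset_para in \<open>auto simp: indicator_def\<close>)
  then show ?thesis
    unfolding set_lebesgue_integral_def using assms by (intro integral_cong_AE) auto
qed

lemma para_integral_translate:
  fixes g :: "real^'n \<Rightarrow> complex"
  assumes g: "continuous_on UNIV g" and per: "periodic_on_lattice e g"
  shows "(LINT x:para e|lborel. g (x + h)) = (LINT x:para e|lborel. g x)"
proof -
  have cont: "continuous_on UNIV (\<lambda>x. g (x + a))" for a
    by (rule continuous_on_compose2[OF g]) (auto intro!: continuous_intros)
  have per': "periodic_on_lattice e (\<lambda>x. g (x + a))" for a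
    unfolding periodic_on_lattice_def
  proof (intro allI ballI)
    fix x l assume "l \<in> lattice e"
    then have "g ((x + a) + l) = g (x + a)"
      using per by (simp add: periodic_on_lattice_def)
    then show "g (x + l + a) = g (x + a)"
      by (simp add: algebra_simps)
  qed
  \<comment> \<open>The shift \<open>h\<close> is built up one basis direction at a time, by
    induction on the set \<open>S\<close> of directions already used; each partial translate of
    \<open>g\<close> is again continuous and periodic.\<close>
  have "(LINT x|lborel. indicator cell x * g (x + (\<Sum>k\<in>S. u k *\<^sub>R e k))) = (LINT x|lborel. indicator cell x * g x)"
    if "finite S" for S u
    using that
  proof induction
    case (insert k S)
    have "(LINT x|lborel. indicator cell x * g (x + (\<Sum>k\<in>insert k S. u k *\<^sub>R e k))) =
        (LINT x|lborel. indicator cell x * g (x + u k *\<^sub>R e k + (\<Sum>k\<in>S. u k *\<^sub>R e k)))"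
      using insert by (simp add: add.assoc)
    also have "\<dots> = (LINT x|lborel. indicator cell x * g (x + (\<Sum>k\<in>S. u k *\<^sub>R e k)))"
      by (rule cell_integral_translate_basis[OF cont per'])
    finally show ?case using insert by simp
  qed simp
  from this[of UNIV "\<lambda>k. coords h $ k"]
  have "(LINT x|lborel. indicator cell x * g (x + h)) = (LINT x|lborel. indicator cell x * g x)"
    by (simp flip: comb_def)
  then show ?thesis
    using cont[of h] g by (simp add: para_integral_eq_cell borel_measurable_continuous_onI)
qed

end

section \<open>The dual lattice\<close>

text \<open>For large r a single term of the exponential series beats the polynomial. With
  \<open>d\<close> the dimension, the polynomial bound factors over coordinates, which handles both
  integrals over the space and sums over the dual lattice.\<close>

lemma exp_minus_powr_le:
  fixes \<epsilon> p :: real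
  assumes \<epsilon>: "\<epsilon> > 0" and p: "p > 0"
  obtains C where "C \<ge> 0" "\<And>r. r \<ge> 0 \<Longrightarrow> exp (- \<epsilon> * r powr p) \<le> C * inverse ((1 + r\<^sup>2) ^ d)"
proof -
  \<comment> \<open>The order is chosen so that r^(2d) is at most (r^p)^m for r > 1.\<close>
  define m where "m = nat \<lceil>2 * real d / p\<rceil>"
  have m: "2 * real d \<le> p * real m"
  proof -
    have "2 * real d / p \<le> real m"
      unfolding m_def by (rule real_nat_ceiling_ge)
    then show ?thesis
      using p by (simp add: pos_divide_le_eq mult.commute)
  qed
  \<comment> \<open>The first summand serves r \<le> 1, where 1 + r^2 is at most 2; the second
    serves r > 1, where it is at most 2 r^2.\<close>
  define C where "C = 2 ^ d * (1 + fact m / \<epsilon> ^ m)"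
  have C: "C \<ge> 2 ^ d" "C \<ge> 2 ^ d * (fact m / \<epsilon> ^ m)" "C \<ge> 0"
    using \<epsilon> by (auto simp: C_def distrib_left)
  have "(1 + r\<^sup>2) ^ d * exp (- \<epsilon> * r powr p) \<le> C" if r: "r \<ge> 0" for r
  proof (cases "r \<le> 1")
    case True
    have "(1 + r\<^sup>2) ^ d * exp (- \<epsilon> * r powr p) \<le> 2 ^ d * 1"
      using True r \<epsilon> power_mono[of r 1 2] by (intro mult_mono power_mono) auto
    then show ?thesis using C by simp
  next
    case False
    have "(1 + r\<^sup>2) ^ d \<le> (2 * r\<^sup>2) ^ d"
      using False one_le_power[of r 2] by (intro power_mono) auto
    also have "\<dots> = 2 ^ d * r powr (2 * real d)"
      using False powr_realpow[of r "2 * d"] by (simp add: power_mult_distrib power_mult)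
    also have "r powr (2 * real d) \<le> r powr (p * real m)"
      using False m by (intro powr_mono) auto
    also have "r powr (p * real m) = (r powr p) ^ m"
      using False by (simp add: powr_powr[symmetric] powr_realpow)
    also have "\<dots> \<le> fact m / \<epsilon> ^ m * exp (\<epsilon> * r powr p)"
    proof -
      have "(\<epsilon> * r powr p) ^ m / fact m \<le> exp (\<epsilon> * r powr p)"
      proof -
        let ?u = "\<epsilon> * r powr p"
        have "(\<Sum>n\<in>{m}. ?u ^ n /\<^sub>R fact n) \<le> (\<Sum>n. ?u ^ n /\<^sub>R fact n)"
          using \<epsilon> by (intro sum_le_suminf sums_summable[OF exp_converges]) auto
        also have "\<dots> = exp ?u"
          by (rule sums_unique[OF exp_converges, symmetric])
        finally show ?thesis by (simp add: divide_inverse mult.commute)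
      qed
      then show ?thesis
        using \<epsilon> by (simp add: power_mult_distrib field_simps)
    qed
    finally have "(1 + r\<^sup>2) ^ d \<le> 2 ^ d * (fact m / \<epsilon> ^ m) * exp (\<epsilon> * r powr p)"
      by (simp add: mult.assoc)
    then have "(1 + r\<^sup>2) ^ d * exp (- \<epsilon> * r powr p) \<le> 2 ^ d * (fact m / \<epsilon> ^ m)"
      by (simp add: exp_minus field_simps)
    then show ?thesis using C by linarith
  qed
  then have "exp (- \<epsilon> * r powr p) \<le> C * inverse ((1 + r\<^sup>2) ^ d)" if "r \<ge> 0" for r
  proof -
    have "(1 + r\<^sup>2) ^ d > 0"
      by (intro zero_less_power add_pos_nonneg) auto
    then show ?thesis
      using \<open>\<And>r. r \<ge> 0 \<Longrightarrow> (1 + r\<^sup>2) ^ d * exp (- \<epsilon> * r powr p) \<le> C\<close>[OF that]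
      by (simp add: field_simps)
  qed
  then show ?thesis using C that by blast
qed

lemma inverse_power_norm_le_decay_weight:
  fixes x :: "real^'n::finite"
  shows "inverse ((1 + (norm x)\<^sup>2) ^ CARD('n)) \<le> decay_weight x"
proof -
  have "(\<Prod>i\<in>(UNIV::'n set). inverse (1 + (norm x)\<^sup>2)) \<le> (\<Prod>i\<in>UNIV. inverse (1 + (x $ i)\<^sup>2))"
  proof (intro prod_mono conjI)
    fix i
    have "(x $ i)\<^sup>2 \<le> (norm x)\<^sup>2"
      using component_le_norm_cart[of x i] by (simp add: abs_le_square_iff[symmetric])
    then show "inverse (1 + (norm x)\<^sup>2) \<le> inverse (1 + (x $ i)\<^sup>2)"
      by (intro le_imp_inverse_le) (auto intro: add_pos_nonneg)
  qed simp
  then show ?thesis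
    by (simp add: decay_weight_def power_inverse)
qed

lemma integrable_exp_minus_norm_powr:
  fixes \<epsilon> p :: real
  assumes "\<epsilon> > 0" "p > 0"
  shows "integrable lborel (\<lambda>x::real^'n::finite. exp (- \<epsilon> * norm x powr p))"
proof -
  obtain C where C: "C \<ge> 0"
    "\<And>r. r \<ge> 0 \<Longrightarrow> exp (- \<epsilon> * r powr p) \<le> C * inverse ((1 + r\<^sup>2) ^ CARD('n))"
    using exp_minus_powr_le[OF assms] by blast
  show ?thesis
  proof (rule Bochner_Integration.integrable_bound)
    show "integrable lborel (\<lambda>x::real^'n. C * decay_weight x)"
      using integrable_decay_weight by (intro integrable_mult_right)
    have "exp (- \<epsilon> * norm x powr p) \<le> C * decay_weight x" for x :: "real^'n"
      using C(2)[of "norm x"] mult_left_mono[OF inverse_power_norm_le_decay_weight[of x] C(1)] by simp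
    then show "AE x::real^'n in lborel. norm (exp (- \<epsilon> * norm x powr p)) \<le> norm (C * decay_weight x)"
      by (intro AE_I2) (auto intro: order_trans[OF _ abs_ge_self])
  qed measurable
qed

lemma abs_summable_inverse_1_plus_int_square:
  "Infinite_Set_Sum.abs_summable_on (\<lambda>m::int. inverse (1 + (real_of_int m)\<^sup>2)) UNIV"
proof -
  have "summable (\<lambda>n. inverse (real n ^ 2))"
    by (rule inverse_power_summable) simp
  then have "summable (\<lambda>n. norm (inverse (1 + (real n)\<^sup>2)))"
  proof (rule summable_comparison_test_ev[rotated])
    show "\<forall>\<^sub>F n in sequentially. norm (norm (inverse (1 + (real n)\<^sup>2))) \<le> inverse (real n ^ 2)"
      using eventually_gt_at_top[of 0]
      by eventually_elim (auto intro!: le_imp_inverse_le)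
  qed
  then have nat: "Infinite_Set_Sum.abs_summable_on (\<lambda>n::nat. inverse (1 + (real n)\<^sup>2)) UNIV"
    by (simp add: abs_summable_on_nat_iff')
  have "Infinite_Set_Sum.abs_summable_on (\<lambda>m::int. inverse (1 + (real_of_int m)\<^sup>2)) (range int)"
    using nat by (subst abs_summable_on_reindex_iff[symmetric]) auto
  moreover have "Infinite_Set_Sum.abs_summable_on (\<lambda>m::int. inverse (1 + (real_of_int m)\<^sup>2)) (range (\<lambda>n. - int n))"
    using nat by (subst abs_summable_on_reindex_iff[symmetric]) (auto simp: inj_on_def)
  ultimately have "Infinite_Set_Sum.abs_summable_on (\<lambda>m::int. inverse (1 + (real_of_int m)\<^sup>2)) (range int \<union> range (\<lambda>n. - int n))"
    by (rule abs_summable_on_union)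
  moreover have "range int \<union> range (\<lambda>n. - int n) = UNIV"
    by (auto simp: image_iff) (metis int_cases2)
  ultimately show ?thesis by simp
qed

context lattice_basis
begin


text \<open>The definite description in \<open>dual_basis\<close> denotes because v -> (e_j . v)_j
  is linear and injective, hence bijective in finite dimension; injectivity holds since the
  \<open>e j\<close> span.\<close>

lemma inner_dual_basis: "e j \<bullet> dual_basis e k = (if j = k then 2 * pi else 0)"
proof -
  define F where "F v = (\<chi> j. e j \<bullet> v)" for v
  have lin: "linear F"
    by (intro linearI) (auto simp: F_def vec_eq_iff inner_add_right)
  have injF: "inj F"
  proof (subst linear_injective_0[OF lin], intro allI impI)
    fix v assume "F v = 0"
    then have "e j \<bullet> v = 0" for j
      by (auto simp: F_def vec_eq_iff)
    then have "comb (coords v) \<bullet> v = 0"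
      unfolding comb_def by (simp add: inner_sum_left)
    then show "v = 0" by simp
  qed
  have "surj F"
    using linear_injective_imp_surjective[OF lin injF] by simp
  then obtain v where v: "F v = (\<chi> j. if j = k then 2 * pi else 0)"
    by (metis surjD)
  have "\<exists>!v. \<forall>j. e j \<bullet> v = (if j = k then 2 * pi else 0)"
  proof (rule ex1I)
    show "\<forall>j. e j \<bullet> v = (if j = k then 2 * pi else 0)"
      using v by (simp add: F_def vec_eq_iff)
    fix w assume "\<forall>j. e j \<bullet> w = (if j = k then 2 * pi else 0)"
    then have "F w = F v"
      using v by (simp add: F_def vec_eq_iff)
    then show "w = v"
      using injF by (simp add: inj_eq)
  qed
  from theI'[OF this] show ?thesis
    unfolding dual_basis_def by blast
qed

definition dual_point :: "('n \<Rightarrow> int) \<Rightarrow> real^'n" where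
  "dual_point m = (\<Sum>k\<in>UNIV. real_of_int (m k) *\<^sub>R dual_basis e k)"

lemma lattice_dual_eq: "lattice (dual_basis e) = range dual_point"
  by (auto simp: lattice_def dual_point_def)

lemma inner_dual_point: "e j \<bullet> dual_point m = 2 * pi * real_of_int (m j)"
proof -
  have "e j \<bullet> dual_point m = (\<Sum>k\<in>UNIV. if j = k then 2 * pi * real_of_int (m k) else 0)"
    unfolding dual_point_def inner_sum_right by (intro sum.cong) (auto simp: inner_dual_basis)
  then show ?thesis by simp
qed

lemma inj_dual_point: "inj dual_point"
proof (rule injI, rule ext)
  fix m m' j assume "dual_point m = dual_point m'"
  then have "2 * pi * real_of_int (m j) = 2 * pi * real_of_int (m' j)"
    by (metis inner_dual_point)
  then show "m j = m' j" by simp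
qed

lemma exp_inner_lattice:
  assumes "l \<in> lattice e" and "\<alpha> \<in> lattice (dual_basis e)"
  shows "exp (- \<i> * complex_of_real (l \<bullet> \<alpha>)) = 1"
proof -
  obtain a where a: "l = (\<Sum>k\<in>UNIV. real_of_int (a k) *\<^sub>R e k)"
    using assms by (auto simp: lattice_def)
  obtain m where m: "\<alpha> = dual_point m"
    using assms by (auto simp: lattice_dual_eq)
  define z where "z = - (\<Sum>k\<in>UNIV. a k * m k)"
  have "l \<bullet> \<alpha> = (\<Sum>k\<in>UNIV. real_of_int (a k) * (2 * pi * real_of_int (m k)))"
    by (simp add: a m inner_sum_left inner_dual_point)
  also have "\<dots> = - 2 * pi * real_of_int z"
    by (simp add: z_def sum_distrib_left sum_negf mult_ac)
  finally have "- \<i> * complex_of_real (l \<bullet> \<alpha>) = 2 * of_int z * of_real pi * \<i>"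
    by simp
  then show ?thesis
    using exp_integer_2pi[of "of_int z"] by (simp add: mult_ac)
qed

text \<open>The integer coordinates of a dual point are its inner products with the
  \<open>e j\<close> divided by 2 pi, so Cauchy-Schwarz bounds them by its norm. The polynomial
  bound is thereby dominated by a product over coordinates, whose sum factors into sums over the
  integers.\<close>

lemma summable_dual_point:
  fixes \<epsilon> p :: real
  assumes \<epsilon>: "\<epsilon> > 0" and p: "p > 0"
  shows "Infinite_Set_Sum.abs_summable_on (\<lambda>m. exp (- \<epsilon> * norm (dual_point m) powr p)) UNIV"
proof -
  obtain C where C: "C \<ge> 0"
    "\<And>r. r \<ge> 0 \<Longrightarrow> exp (- \<epsilon> * r powr p) \<le> C * inverse ((1 + r\<^sup>2) ^ CARD('n))"
    using exp_minus_powr_le[OF assms] by blast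
  \<comment> \<open>One constant, at least 1 and at least every squared basis length, so that the
    comparison is the same in each coordinate.\<close>
  define Q where "Q = 1 + (\<Sum>j\<in>UNIV. (norm (e j))\<^sup>2)"
  have Q: "Q \<ge> 1" "(norm (e j))\<^sup>2 \<le> Q" for j
  proof -
    have "(norm (e j))\<^sup>2 \<le> (\<Sum>j\<in>UNIV. (norm (e j))\<^sup>2)"
      by (rule member_le_sum) auto
    then show "(norm (e j))\<^sup>2 \<le> Q" by (simp add: Q_def)
    show "Q \<ge> 1" by (simp add: Q_def sum_nonneg)
  qed
  have comp: "1 + (real_of_int (m j))\<^sup>2 \<le> Q * (1 + (norm (dual_point m))\<^sup>2)" for m j
  proof -
    have "\<bar>real_of_int (m j)\<bar> \<le> \<bar>2 * pi * real_of_int (m j)\<bar>"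
      using pi_ge_two by (simp add: abs_mult mult_le_cancel_right1)
    also have "\<dots> \<le> norm (e j) * norm (dual_point m)"
      using Cauchy_Schwarz_ineq2[of "e j" "dual_point m"] by (simp add: inner_dual_point)
    finally have "(real_of_int (m j))\<^sup>2 \<le> (norm (e j) * norm (dual_point m))\<^sup>2"
      by (metis abs_ge_zero power2_abs power_mono)
    also have "\<dots> \<le> Q * (norm (dual_point m))\<^sup>2"
      using Q(2)[of j] by (simp add: power_mult_distrib mult_right_mono)
    finally show ?thesis
      using Q(1) by (simp add: algebra_simps)
  qed
  have "Infinite_Set_Sum.abs_summable_on (\<lambda>m. \<Prod>j\<in>UNIV. inverse (1 + (real_of_int (m j))\<^sup>2)) (PiE (UNIV::'n set) (\<lambda>_. UNIV))"
    using abs_summable_inverse_1_plus_int_square by (intro abs_summable_on_prod_PiE) auto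
  then have "Infinite_Set_Sum.abs_summable_on (\<lambda>m. C * Q ^ CARD('n) * (\<Prod>j\<in>(UNIV::'n set). inverse (1 + (real_of_int (m j))\<^sup>2))) UNIV"
    by (intro abs_summable_on_cmult_right) simp
  then show ?thesis
  proof (rule abs_summable_on_comparison_test)
    fix m :: "'n \<Rightarrow> int"
    have "(\<Prod>j\<in>(UNIV::'n set). 1 + (real_of_int (m j))\<^sup>2) \<le> (\<Prod>j\<in>(UNIV::'n set). Q * (1 + (norm (dual_point m))\<^sup>2))"
      by (intro prod_mono conjI comp) simp
    then have le: "(\<Prod>j\<in>(UNIV::'n set). 1 + (real_of_int (m j))\<^sup>2) \<le> Q ^ CARD('n) * (1 + (norm (dual_point m))\<^sup>2) ^ CARD('n)"
      by (simp add: power_mult_distrib)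
    have pos: "(\<Prod>j\<in>(UNIV::'n set). 1 + (real_of_int (m j))\<^sup>2) > 0" "(1 + (norm (dual_point m))\<^sup>2) ^ CARD('n) > 0"
      by (auto intro!: prod_pos zero_less_power intro: add_pos_nonneg)
    have "inverse ((1 + (norm (dual_point m))\<^sup>2) ^ CARD('n)) \<le> Q ^ CARD('n) * inverse (\<Prod>j\<in>(UNIV::'n set). 1 + (real_of_int (m j))\<^sup>2)"
      using le pos by (simp add: field_simps)
    then have "C * inverse ((1 + (norm (dual_point m))\<^sup>2) ^ CARD('n)) \<le> C * (Q ^ CARD('n) * inverse (\<Prod>j\<in>(UNIV::'n set). 1 + (real_of_int (m j))\<^sup>2))"
      using C(1) by (rule mult_left_mono)
    then have "exp (- \<epsilon> * norm (dual_point m) powr p) \<le> C * Q ^ CARD('n) * (\<Prod>j\<in>(UNIV::'n set). inverse (1 + (real_of_int (m j))\<^sup>2))"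
      using C(2)[of "norm (dual_point m)"] by (simp add: mult.assoc flip: prod_inversef)
    then show "norm (exp (- \<epsilon> * norm (dual_point m) powr p)) \<le> norm (C * Q ^ CARD('n) * (\<Prod>j\<in>(UNIV::'n set). inverse (1 + (real_of_int (m j))\<^sup>2)))"
      by (auto intro: order_trans[OF _ abs_ge_self])
  qed
qed

text \<open>An enumeration of the dual lattice by natural numbers, so that termwise integration of
  series applies; absolute convergence makes the order immaterial.\<close>

definition dual_seq :: "nat \<Rightarrow> real^'n" where
  "dual_seq n = dual_point (from_nat_into UNIV n)"

lemma bij_from_nat: "bij_betw (from_nat_into (UNIV :: ('n \<Rightarrow> int) set)) UNIV UNIV"
proof (rule bij_betw_from_nat_into)
  have "inj (\<lambda>z::int. \<lambda>_::'n. z)"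
    by (auto simp: inj_on_def fun_eq_iff)
  then show "infinite (UNIV :: ('n \<Rightarrow> int) set)"
    by (metis finite_imageD finite_subset infinite_UNIV_int subset_UNIV)
qed simp

lemma bij_dual_seq: "bij_betw dual_seq UNIV (lattice (dual_basis e))"
  unfolding lattice_dual_eq
  using bij_betw_trans[OF bij_from_nat inj_on_imp_bij_betw[OF inj_dual_point]]
  by (simp add: dual_seq_def[abs_def] o_def)

lemma dual_seq_in_lattice: "dual_seq n \<in> lattice (dual_basis e)"
  using bij_dual_seq by (auto simp: bij_betw_def)

lemma summable_dual_seq:
  fixes \<epsilon> p :: real
  assumes "\<epsilon> > 0" and "p > 0"
  shows "summable (\<lambda>n. exp (- \<epsilon> * norm (dual_seq n) powr p))"
proof -
  have "Infinite_Set_Sum.abs_summable_on (\<lambda>n. exp (- \<epsilon> * norm (dual_point (from_nat_into UNIV n)) powr p)) UNIV"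
    using abs_summable_on_reindex_bij_betw[OF bij_from_nat, where f = "\<lambda>m. exp (- \<epsilon> * norm (dual_point m) powr p)"]
      summable_dual_point[OF assms] by blast
  then show ?thesis
    by (simp add: abs_summable_on_nat_iff' dual_seq_def)
qed

lemma infsum_lattice_dual:
  fixes f :: "real^'n \<Rightarrow> complex"
  assumes "summable (\<lambda>n. norm (f (dual_seq n)))"
  shows "(\<Sum>\<^sub>\<infinity>\<alpha>\<in>lattice (dual_basis e). f \<alpha>) = (\<Sum>n. f (dual_seq n))"
proof -
  have "(\<Sum>\<^sub>\<infinity>\<alpha>\<in>lattice (dual_basis e). f \<alpha>) = (\<Sum>\<^sub>\<infinity>n. f (dual_seq n))"
    by (rule infsum_reindex_bij_betw[OF bij_dual_seq, symmetric])
  also have "\<dots> = (\<Sum>n. f (dual_seq n))"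
    by (intro infsumI norm_summable_imp_has_sum assms summable_sums summable_norm_cancel[OF assms])
  finally show ?thesis .
qed

end

section \<open>The short-time Fourier transform\<close>

lemma fourier_cnj_window:
  "fourier (\<lambda>y. cnj (\<phi> (y - x)) * exp (- \<i> * complex_of_real (y \<bullet> \<xi>))) (- \<alpha>) =
     exp (- \<i> * complex_of_real (x \<bullet> (\<xi> - \<alpha>))) * cnj (fourier \<phi> (\<alpha> - \<xi>))"
proof -
  let ?f = "\<lambda>y. exp (- \<i> * complex_of_real (x \<bullet> (\<xi> - \<alpha>))) * cnj (\<phi> y * exp (- \<i> * complex_of_real (y \<bullet> (\<alpha> - \<xi>))))"
  have eq: "cnj (\<phi> (y - x)) * exp (- \<i> * complex_of_real (y \<bullet> \<xi>)) * exp (- \<i> * complex_of_real (y \<bullet> (- \<alpha>))) =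
      ?f (y + (- x))" for y
    by (simp add: exp_cnj mult_ac exp_add[symmetric] inner_diff_left inner_diff_right) (simp add: algebra_simps)
  have "(LINT y|lborel. cnj (\<phi> (y - x)) * exp (- \<i> * complex_of_real (y \<bullet> \<xi>)) * exp (- \<i> * complex_of_real (y \<bullet> (- \<alpha>)))) =
      (LINT y|lborel. ?f y)"
    unfolding eq by (rule lborel_integral_translate)
  also have "\<dots> = exp (- \<i> * complex_of_real (x \<bullet> (\<xi> - \<alpha>))) *
      cnj (LINT y|lborel. \<phi> y * exp (- \<i> * complex_of_real (y \<bullet> (\<alpha> - \<xi>))))"
    by (simp only: integral_mult_right_zero Bochner_Integration.integral_cnj)
  finally show ?thesis
    by (simp add: fourier_def mult_ac)
qed

lemma stft_dist_eq:
  fixes e :: "'n::finite \<Rightarrow> real^'n"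
  shows "stft_dist e \<phi> c x \<xi> = (\<Sum>\<^sub>\<infinity>\<alpha>\<in>lattice (dual_basis e).
     c \<alpha> * (exp (- \<i> * complex_of_real (x \<bullet> (\<xi> - \<alpha>))) * cnj (fourier \<phi> (\<alpha> - \<xi>))))"
proof -
  \<comment> \<open>The normalizations in \<open>stft_dist\<close> and \<open>dist_pair\<close> are
    reciprocal.\<close>
  have "complex_of_real ((2 * pi) powr (- real CARD('n) / 2)) * complex_of_real ((2 * pi) powr (real CARD('n) / 2)) = 1"
    by (simp flip: of_real_mult powr_add)
  then show ?thesis
    unfolding stft_dist_def dist_pair_def fourier_cnj_window by (simp flip: mult.assoc)
qed

lemma stft_translate:
  "stft \<phi> \<psi> x \<xi> = complex_of_real ((2 * pi) powr (- real CARD('n) / 2)) *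
     (LINT z|lborel. \<psi> (x + z) * cnj (\<phi> z) * exp (- \<i> * complex_of_real ((x + z) \<bullet> \<xi>)))"
  for \<phi> :: "real^'n::finite \<Rightarrow> complex"
  using lborel_integral_translate[of "\<lambda>z. \<psi> (x + z) * cnj (\<phi> z) * exp (- \<i> * complex_of_real ((x + z) \<bullet> \<xi>))" "- x"]
  by (simp add: stft_def fourier_def)

lemma borel_measurable_fourier:
  assumes [measurable]: "g \<in> borel_measurable borel"
  shows "fourier g \<in> borel_measurable borel"
  unfolding fourier_def by measurable

lemma borel_measurable_stft:
  fixes \<phi> \<psi> :: "real^'n::finite \<Rightarrow> complex"
  assumes [measurable]: "\<phi> \<in> borel_measurable borel" "\<psi> \<in> borel_measurable borel"
  shows "(\<lambda>(x, \<xi>). stft \<phi> \<psi> x \<xi>) \<in> borel_measurable (lborel \<Otimes>\<^sub>M lborel)"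
  unfolding stft_def fourier_def by measurable

text \<open>Comparison with twice the larger norm treats exponents below and above 1 alike, where
  convexity would not; this is the source of the factor 2^p.\<close>

lemma powr_norm_triangle:
  fixes a b :: "'a::real_normed_vector" and p :: real
  assumes p: "p > 0"
  shows "norm (a + b) powr p \<le> 2 powr p * (norm a powr p + norm b powr p)"
proof -
  have "norm (a + b) powr p \<le> (2 * max (norm a) (norm b)) powr p"
    using p norm_triangle_ineq[of a b] by (intro powr_mono2) auto
  also have "\<dots> = 2 powr p * max (norm a) (norm b) powr p"
    by (rule powr_mult)
  also have "max (norm a) (norm b) powr p \<le> norm a powr p + norm b powr p"
    by (auto simp: max_def)
  finally show ?thesis by (simp add: mult_left_mono)
qed

context lattice_basis
begin

lemma para_integral_stft:
  fixes \<phi> \<psi> :: "real^'n \<Rightarrow> complex"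
  assumes \<phi>: "integrable lborel \<phi>"
    and \<psi>: "continuous_on UNIV \<psi>" and bdd: "\<And>y. cmod (\<psi> y) \<le> A" and per: "periodic_on_lattice e \<psi>"
    and \<alpha>: "\<alpha> \<in> lattice (dual_basis e)"
  shows "(LINT x|lborel. indicator (para e) x * (exp (\<i> * complex_of_real (x \<bullet> (\<xi> - \<alpha>))) * stft \<phi> \<psi> x \<xi>)) =
     complex_of_real (measure lborel (para e)) * fcoeff e \<psi> \<alpha> * cnj (fourier \<phi> (\<alpha> - \<xi>))"
proof -
  let ?K = "complex_of_real ((2 * pi) powr (- real CARD('n) / 2))"
  \<comment> \<open>The characters are distributed so that the integrand becomes
    \<open>h z * g (x + z)\<close>: \<open>g\<close> is lattice-periodic because \<alpha> is a dual
    lattice point, and \<open>h\<close> carries the window alone.\<close>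
  define g where "g y = \<psi> y * exp (- \<i> * complex_of_real (y \<bullet> \<alpha>))" for y
  define h where "h z = cnj (\<phi> z * exp (- \<i> * complex_of_real (z \<bullet> (\<alpha> - \<xi>))))" for z
  have [measurable]: "\<phi> \<in> borel_measurable borel" "\<psi> \<in> borel_measurable borel"
    using borel_measurable_integrable[OF \<phi>] borel_measurable_continuous_onI[OF \<psi>] by auto
  have [measurable]: "g \<in> borel_measurable borel" "h \<in> borel_measurable borel"
    unfolding g_def h_def by measurable
  have g_cont: "continuous_on UNIV g"
    unfolding g_def by (intro continuous_intros \<psi>)
  have g_per: "periodic_on_lattice e g"
    unfolding periodic_on_lattice_def
  proof (intro allI ballI)
    fix x l assume l: "l \<in> lattice e"
    have "exp (- \<i> * complex_of_real ((x + l) \<bullet> \<alpha>)) =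
        exp (- \<i> * complex_of_real (x \<bullet> \<alpha>)) * exp (- \<i> * complex_of_real (l \<bullet> \<alpha>))"
      by (simp add: exp_add[symmetric] inner_add_left algebra_simps)
    then show "g (x + l) = g x"
      using per l exp_inner_lattice[OF l \<alpha>] by (simp add: g_def periodic_on_lattice_def)
  qed
  have h_int: "integrable lborel h"
    by (rule Bochner_Integration.integrable_bound[OF \<phi>]) (auto simp: h_def norm_mult)
  have para_int: "integrable lborel (\<lambda>x. indicator (para e) x * A)"
    using emeasure_compact_finite[OF compact_para] by (intro integrable_mult_left integrable_real_indicator) auto
  have integrand: "exp (\<i> * complex_of_real (x \<bullet> (\<xi> - \<alpha>))) * stft \<phi> \<psi> x \<xi> = ?K * (LINT z|lborel. h z * g (x + z))" for x
  proof -
    have "exp (\<i> * complex_of_real (x \<bullet> (\<xi> - \<alpha>))) * (\<psi> (x + z) * cnj (\<phi> z) * exp (- \<i> * complex_of_real ((x + z) \<bullet> \<xi>)))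
        = h z * g (x + z)" for z
    proof -
      have "exp (\<i> * complex_of_real (x \<bullet> (\<xi> - \<alpha>))) * exp (- \<i> * complex_of_real ((x + z) \<bullet> \<xi>)) =
          exp (\<i> * complex_of_real (z \<bullet> (\<alpha> - \<xi>))) * exp (- \<i> * complex_of_real ((x + z) \<bullet> \<alpha>))"
        by (simp add: exp_add[symmetric] inner_add_left inner_diff_right algebra_simps)
      moreover have "cnj (exp (- \<i> * complex_of_real (z \<bullet> (\<alpha> - \<xi>)))) = exp (\<i> * complex_of_real (z \<bullet> (\<alpha> - \<xi>)))"
        by (simp add: exp_cnj)
      ultimately show ?thesis
        by (simp add: h_def g_def mult_ac)
    qed
    then have eq: "exp (\<i> * complex_of_real (x \<bullet> (\<xi> - \<alpha>))) *
        (LINT z|lborel. \<psi> (x + z) * cnj (\<phi> z) * exp (- \<i> * complex_of_real ((x + z) \<bullet> \<xi>))) =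
        (LINT z|lborel. h z * g (x + z))"
      by (simp only: integral_mult_right_zero[symmetric])
    show ?thesis
      unfolding stft_translate by (subst mult.left_commute) (simp only: eq)
  qed
  \<comment> \<open>Fubini is legitimate since \<open>h\<close> is integrable, \<open>g\<close> is
    bounded by \<open>A\<close>, and E has finite measure.\<close>
  have "integrable (lborel \<Otimes>\<^sub>M lborel) (\<lambda>(x, z). indicator (para e) x * (h z * g (x + z)))"
  proof (rule integrable_pair_bound[OF _ para_int])
    show "integrable lborel (\<lambda>z. cmod (h z))"
      using h_int by simp
    show "norm (case (x, z) of (x, z) \<Rightarrow> indicator (para e) x * (h z * g (x + z))) \<le> indicator (para e) x * A * cmod (h z)" for x z
      using mult_right_mono[OF bdd[of "x + z"], of "cmod (h z)"]
      by (simp add: norm_mult g_def indicator_def mult.commute)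
  qed measurable
  then have "(LINT z|lborel. (LINT x|lborel. indicator (para e) x * (h z * g (x + z)))) =
      (LINT x|lborel. (LINT z|lborel. indicator (para e) x * (h z * g (x + z))))"
    by (rule lborel_pair.Fubini_integral)
  moreover have "(LINT x|lborel. indicator (para e) x * (h z * g (x + z))) = h z * (LINT x:para e|lborel. g x)" for z
  proof -
    have "(LINT x|lborel. indicator (para e) x * (h z * g (x + z))) = h z * (LINT x|lborel. indicator (para e) x * g (x + z))"
      by (simp only: mult.left_commute[of _ "h z"] integral_mult_right_zero)
    also have "(LINT x|lborel. indicator (para e) x * g (x + z)) = (LINT x:para e|lborel. g (x + z))"
      unfolding set_lebesgue_integral_def
      by (intro Bochner_Integration.integral_cong) (auto simp: indicator_def)
    also have "\<dots> = (LINT x:para e|lborel. g x)"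
      by (rule para_integral_translate[OF g_cont g_per])
    finally show ?thesis .
  qed
  ultimately have "(LINT x|lborel. indicator (para e) x * (LINT z|lborel. h z * g (x + z))) =
      (LINT z|lborel. h z) * (LINT x:para e|lborel. g x)"
    by simp
  then have "(LINT x|lborel. indicator (para e) x * (exp (\<i> * complex_of_real (x \<bullet> (\<xi> - \<alpha>))) * stft \<phi> \<psi> x \<xi>)) =
      ?K * ((LINT z|lborel. h z) * (LINT x:para e|lborel. g x))"
    unfolding integrand by (simp only: mult.left_commute[of _ "?K"] integral_mult_right_zero)
  moreover have "?K * (LINT z|lborel. h z) = cnj (fourier \<phi> (\<alpha> - \<xi>))"
    unfolding h_def by (simp only: Bochner_Integration.integral_cnj) (simp add: fourier_def)
  moreover have "(LINT x:para e|lborel. g x) = complex_of_real (measure lborel (para e)) * fcoeff e \<psi> \<alpha>"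
    using measure_para_pos by (simp add: fcoeff_def g_def)
  ultimately show ?thesis
    by (simp add: mult_ac)
qed

end

section \<open>The Moyal identity\<close>

text \<open>A vanishing norm makes the set where \<phi> is nonzero both null and, by continuity,
  open, hence empty.\<close>

lemma L2_norm_pos:
  fixes \<phi> :: "real^'n::finite \<Rightarrow> complex"
  assumes cont: "continuous_on UNIV \<phi>" and int: "integrable lborel (\<lambda>y. (cmod (\<phi> y))\<^sup>2)"
    and nz: "\<phi> \<noteq> (\<lambda>_. 0)"
  shows "(LINT y|lborel. (cmod (\<phi> y))\<^sup>2) > 0"
proof (rule ccontr)
  assume "\<not> ?thesis"
  then have "(LINT y|lborel. (cmod (\<phi> y))\<^sup>2) = 0"
    by (metis integral_nonneg_AE AE_I2 zero_le_power2 linorder_not_less order_antisym)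
  then have "AE y in lborel. (cmod (\<phi> y))\<^sup>2 = 0"
    using integral_nonneg_eq_0_iff_AE[OF int] by simp
  then have ae: "AE y in lborel. \<phi> y = 0"
    by simp
  let ?U = "{y. \<phi> y \<noteq> 0}"
  have op: "open ?U"
    using cont by (intro open_Collect_neq continuous_intros)
  then have "?U \<in> null_sets lborel"
    using ae by (simp add: AE_iff_null_sets)
  then have "negligible ?U"
    by (simp add: negligible_iff_null_sets null_sets_completionI)
  moreover have "?U \<noteq> {}"
    using nz by auto
  ultimately show False
    using op open_not_negligible by blast
qed

context lattice_basis
begin

text \<open>The factor 4 * 2^p in \<delta> is a budget. Twice \<epsilon> |\<alpha>|^p, once for the
  growth of \<open>c\<close> and once for a summable remainder, costs (\<delta>/2)(|\<alpha> -
  \<xi>|^p + |\<xi>|^p). The transform of \<phi> pays the first part and \<open>stft\<close> the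
  second, with \<delta>/2 left over for integrability in \<xi>.\<close>

lemma stft_moyal:
  fixes \<phi> \<psi> c :: "real^'n \<Rightarrow> complex" and \<epsilon> p \<delta> :: real
  assumes \<phi>: "continuous_on UNIV \<phi>" and \<phi>_decay: "\<And>y. cmod (\<phi> y) \<le> B * decay_weight y"
    and nz: "\<phi> \<noteq> (\<lambda>_. 0)"
    and \<psi>: "continuous_on UNIV \<psi>" and bdd: "\<And>y. cmod (\<psi> y) \<le> A" and per: "periodic_on_lattice e \<psi>"
    and \<epsilon>: "\<epsilon> > 0" and p: "p > 0" and \<delta>: "\<delta> = 4 * 2 powr p * \<epsilon>"
    and c: "\<And>\<alpha>. \<alpha> \<in> lattice (dual_basis e) \<Longrightarrow> cmod (c \<alpha>) \<le> C\<^sub>0 * exp (\<epsilon> * norm \<alpha> powr p)"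
    and F: "\<And>\<eta>. cmod (fourier \<phi> \<eta>) \<le> C\<^sub>1 * exp (- \<delta> * norm \<eta> powr p)"
    and V: "\<And>x \<xi>. cmod (stft \<phi> \<psi> x \<xi>) \<le> C\<^sub>2 * exp (- \<delta> * norm \<xi> powr p)"
  shows "set_integrable lborel (para e \<times> UNIV)
            (\<lambda>(x, \<xi>). stft_dist e \<phi> c x \<xi> * cnj (stft \<phi> \<psi> x \<xi>))" (is ?integrable)
    and "per_pair e c \<psi> =
            inverse (complex_of_real ((LINT y|lborel. (cmod (\<phi> y))\<^sup>2) * measure lborel (para e))) *
            (LINT x:para e|lborel. (LINT \<xi>|lborel. stft_dist e \<phi> c x \<xi> * cnj (stft \<phi> \<psi> x \<xi>)))" (is ?formula)
proof -
  let ?M = "(lborel :: (real^'n) measure) \<Otimes>\<^sub>M (lborel :: (real^'n) measure)"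
  have [measurable]: "\<phi> \<in> borel_measurable borel" "\<psi> \<in> borel_measurable borel"
    using borel_measurable_continuous_onI[OF \<phi>] borel_measurable_continuous_onI[OF \<psi>] by auto
  note [measurable] = borel_measurable_fourier[OF \<open>\<phi> \<in> borel_measurable borel\<close>]
    borel_measurable_stft[OF \<open>\<phi> \<in> borel_measurable borel\<close> \<open>\<psi> \<in> borel_measurable borel\<close>]
  have \<phi>_int: "integrable lborel \<phi>"
    by (rule Bochner_Integration.integrable_bound[OF integrable_mult_right[OF integrable_decay_weight, of B]])
      (auto intro!: order_trans[OF \<phi>_decay])
  have B: "B \<ge> 0"
    using order_trans[OF norm_ge_zero \<phi>_decay[of 0]] decay_weight_pos[of "0::real^'n"]
    by (simp add: zero_le_mult_iff)
  have \<phi>_bdd: "cmod (\<phi> y) \<le> B" for y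
    using \<phi>_decay[of y] mult_left_mono[OF decay_weight_le_1[of y] B] by simp
  have \<phi>_sq: "integrable lborel (\<lambda>y. (cmod (\<phi> y))\<^sup>2)"
  proof (rule Bochner_Integration.integrable_bound[OF integrable_mult_right[OF integrable_norm[OF \<phi>_int], of B]])
    show "AE y in lborel. norm ((cmod (\<phi> y))\<^sup>2) \<le> norm (B * cmod (\<phi> y))"
      using \<phi>_bdd B by (intro AE_I2) (auto simp: power2_eq_square intro: mult_right_mono)
  qed measurable
  have \<delta>0: "\<delta> > 0"
    using \<epsilon> by (simp add: \<delta>)
  have exp_le_1: "exp (- \<delta> * norm \<eta> powr p) \<le> 1" for \<eta> :: "real^'n"
    using \<delta>0 by simp
  have C1: "C\<^sub>1 \<ge> 0"
    using order_trans[OF norm_ge_zero F[of 0]] by (simp add: zero_le_mult_iff)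
  have C2: "C\<^sub>2 \<ge> 0"
    using order_trans[OF norm_ge_zero V[of 0 0]] by (simp add: zero_le_mult_iff)
  have C0: "C\<^sub>0 \<ge> 0"
    using order_trans[OF norm_ge_zero c[OF dual_seq_in_lattice]] by (simp add: zero_le_mult_iff)
  have F_sq: "integrable lborel (\<lambda>\<eta>. (cmod (fourier \<phi> \<eta>))\<^sup>2)"
  proof (rule Bochner_Integration.integrable_bound[OF integrable_mult_right[OF integrable_exp_minus_norm_powr[OF \<delta>0 p], of "C\<^sub>1 * C\<^sub>1"]])
    have "(cmod (fourier \<phi> \<eta>))\<^sup>2 \<le> C\<^sub>1 * C\<^sub>1 * exp (- \<delta> * norm \<eta> powr p)" for \<eta>
    proof -
      have "cmod (fourier \<phi> \<eta>) \<le> C\<^sub>1"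
        using F[of \<eta>] mult_left_mono[OF exp_le_1 C1, of \<eta>] by simp
      then have "cmod (fourier \<phi> \<eta>) * cmod (fourier \<phi> \<eta>) \<le> C\<^sub>1 * (C\<^sub>1 * exp (- \<delta> * norm \<eta> powr p))"
        using C1 F by (intro mult_mono) auto
      then show ?thesis by (simp add: power2_eq_square mult.assoc)
    qed
    then show "AE \<eta> in lborel. norm ((cmod (fourier \<phi> \<eta>))\<^sup>2) \<le> norm (C\<^sub>1 * C\<^sub>1 * exp (- \<delta> * norm \<eta> powr p))"
      by (intro AE_I2) (auto intro: order_trans[OF _ abs_ge_self])
  qed measurable
  define N where "N = (LINT y|lborel. (cmod (\<phi> y))\<^sup>2)"
  have N: "N > 0"
    unfolding N_def by (rule L2_norm_pos[OF \<phi> \<phi>_sq nz])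
  \<comment> \<open>Reflection and translation reduce this to Plancherel; the value does not depend
    on \<alpha>, so it can be taken out of the final sum.\<close>
  have plancherel_shift: "(LINT \<xi>|lborel. (cmod (fourier \<phi> (\<alpha> - \<xi>)))\<^sup>2) = N" for \<alpha>
  proof -
    have "(LINT \<xi>|lborel. (cmod (fourier \<phi> (\<alpha> - \<xi>)))\<^sup>2) = (LINT \<xi>|lborel. (cmod (fourier \<phi> (\<alpha> + \<xi>)))\<^sup>2)"
      using lborel_integral_reflect[of "\<lambda>\<xi>. (cmod (fourier \<phi> (\<alpha> + \<xi>)))\<^sup>2"] by simp
    also have "\<dots> = (LINT \<xi>|lborel. (cmod (fourier \<phi> \<xi>))\<^sup>2)"
      using lborel_integral_translate[of "\<lambda>\<xi>. (cmod (fourier \<phi> \<xi>))\<^sup>2" \<alpha>] by (simp add: add.commute)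
    also have "\<dots> = N"
      unfolding N_def by (rule plancherel[OF \<phi> \<phi>_bdd \<phi>_int F_sq])
    finally show ?thesis .
  qed

  define E where "E n = exp (- \<epsilon> * norm (dual_seq n) powr p)" for n
  have summE: "summable E"
    unfolding E_def by (rule summable_dual_seq[OF \<epsilon> p])
  define T where "T n x \<xi> = c (dual_seq n) *
    (exp (- \<i> * complex_of_real (x \<bullet> (\<xi> - dual_seq n))) * cnj (fourier \<phi> (dual_seq n - \<xi>)))" for n x \<xi>
  \<comment> \<open>The \<xi>-dependence and the n-dependence are separated, at the price of growth
    in \<xi> at half the rate of decay of \<open>stft\<close>.\<close>
  have T_le: "cmod (T n x \<xi>) \<le> C\<^sub>0 * C\<^sub>1 * exp (\<delta> / 2 * norm \<xi> powr p) * E n" for n x \<xi>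
  proof -
    let ?\<alpha> = "dual_seq n"
    have "norm ?\<alpha> powr p \<le> 2 powr p * (norm (?\<alpha> - \<xi>) powr p + norm \<xi> powr p)"
      using powr_norm_triangle[OF p, of "?\<alpha> - \<xi>" \<xi>] by simp
    then have "2 * \<epsilon> * norm ?\<alpha> powr p \<le> 2 * \<epsilon> * (2 powr p * (norm (?\<alpha> - \<xi>) powr p + norm \<xi> powr p))"
      using \<epsilon> by (intro mult_left_mono) auto
    also have "\<dots> = \<delta> / 2 * norm (?\<alpha> - \<xi>) powr p + \<delta> / 2 * norm \<xi> powr p"
      by (simp add: \<delta> algebra_simps)
    also have "\<dots> \<le> \<delta> * norm (?\<alpha> - \<xi>) powr p + \<delta> / 2 * norm \<xi> powr p"
      using \<delta>0 by simp
    finally have expo: "\<epsilon> * norm ?\<alpha> powr p + - \<delta> * norm (?\<alpha> - \<xi>) powr p \<le>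
        \<delta> / 2 * norm \<xi> powr p + - \<epsilon> * norm ?\<alpha> powr p"
      by simp
    have "cmod (T n x \<xi>) = cmod (c ?\<alpha>) * cmod (fourier \<phi> (?\<alpha> - \<xi>))"
      by (simp add: T_def norm_mult)
    also have "\<dots> \<le> (C\<^sub>0 * exp (\<epsilon> * norm ?\<alpha> powr p)) * (C\<^sub>1 * exp (- \<delta> * norm (?\<alpha> - \<xi>) powr p))"
      using C0 by (intro mult_mono c dual_seq_in_lattice F) auto
    also have "\<dots> = C\<^sub>0 * C\<^sub>1 * exp (\<epsilon> * norm ?\<alpha> powr p + - \<delta> * norm (?\<alpha> - \<xi>) powr p)"
      by (simp only: exp_add mult_ac)
    also have "\<dots> \<le> C\<^sub>0 * C\<^sub>1 * exp (\<delta> / 2 * norm \<xi> powr p + - \<epsilon> * norm ?\<alpha> powr p)"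
      using expo C0 C1 by (intro mult_left_mono) auto
    also have "\<dots> = C\<^sub>0 * C\<^sub>1 * exp (\<delta> / 2 * norm \<xi> powr p) * E n"
      by (simp only: exp_add E_def mult_ac)
    finally show ?thesis .
  qed
  have T_summable: "summable (\<lambda>n. norm (T n x \<xi>))" for x \<xi>
    by (rule summable_comparison_test[OF _ summable_mult[OF summE]]) (use T_le in auto)
  have stft_dist: "stft_dist e \<phi> c x \<xi> = (\<Sum>n. T n x \<xi>)" for x \<xi>
    unfolding stft_dist_eq T_def by (rule infsum_lattice_dual) (use T_summable in \<open>simp add: T_def\<close>)

  define H where "H n z = (case z of (x, \<xi>) \<Rightarrow> indicator (para e) x * (T n x \<xi> * cnj (stft \<phi> \<psi> x \<xi>)))" for n z
  \<comment> \<open>The integrable remainder of growth at rate \<delta>/2 against decay at rate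
    \<delta>; up to constants, \<open>w z * E n\<close> dominates the n-th term.\<close>
  define w where "w z = (case z of (x, \<xi>) \<Rightarrow> indicator (para e) x * exp (- (\<delta> / 2) * norm \<xi> powr p))" for z :: "(real^'n) \<times> (real^'n)"
  have H_meas: "H n \<in> borel_measurable ?M" for n
    unfolding H_def T_def by measurable
  have w_meas: "w \<in> borel_measurable ?M"
    unfolding w_def by measurable
  have w_int: "integrable ?M w"
  proof (rule integrable_pair_bound[OF w_meas])
    show "integrable lborel (indicator (para e) :: _ \<Rightarrow> real)"
      using emeasure_compact_finite[OF compact_para] by (intro integrable_real_indicator) auto
    show "integrable lborel (\<lambda>\<xi>::real^'n. exp (- (\<delta> / 2) * norm \<xi> powr p))"
      using \<delta>0 p by (intro integrable_exp_minus_norm_powr) auto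
  qed (simp add: w_def)
  have H_le: "norm (H n z) \<le> C\<^sub>0 * C\<^sub>1 * C\<^sub>2 * w z * E n" for n z
  proof -
    obtain x \<xi> where z: "z = (x, \<xi>)" by (cases z)
    have "cmod (T n x \<xi>) * cmod (stft \<phi> \<psi> x \<xi>) \<le>
        (C\<^sub>0 * C\<^sub>1 * exp (\<delta> / 2 * norm \<xi> powr p) * E n) * (C\<^sub>2 * exp (- \<delta> * norm \<xi> powr p))"
      using C0 C1 by (intro mult_mono T_le V) (auto simp: E_def)
    also have "\<dots> = C\<^sub>0 * C\<^sub>1 * C\<^sub>2 * exp (\<delta> / 2 * norm \<xi> powr p + - \<delta> * norm \<xi> powr p) * E n"
      by (simp only: exp_add mult_ac)
    also have "\<delta> / 2 * norm \<xi> powr p + - \<delta> * norm \<xi> powr p = - (\<delta> / 2) * norm \<xi> powr p"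
      by simp
    finally show ?thesis
      by (auto simp: z H_def w_def norm_mult indicator_def)
  qed
  have H_int: "integrable ?M (H n)" for n
  proof (rule Bochner_Integration.integrable_bound)
    show "integrable ?M (\<lambda>z. C\<^sub>0 * C\<^sub>1 * C\<^sub>2 * w z * E n)"
      using w_int by simp
    show "AE z in ?M. norm (H n z) \<le> norm (C\<^sub>0 * C\<^sub>1 * C\<^sub>2 * w z * E n)"
      using H_le by (intro AE_I2) (auto intro: order_trans[OF _ abs_ge_self])
  qed (rule H_meas)
  have H_summable: "summable (\<lambda>n. norm (H n z))" for z
    by (rule summable_comparison_test[OF _ summable_mult[OF summE, of "C\<^sub>0 * C\<^sub>1 * C\<^sub>2 * w z"]])
      (use H_le[of _ z] in auto)
  have H_norm_summable: "summable (\<lambda>n. LINT z|?M. norm (H n z))"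
  proof (rule summable_comparison_test[OF _ summable_mult[OF summE]], intro exI allI impI)
    fix n
    have "(LINT z|?M. norm (H n z)) \<le> (LINT z|?M. C\<^sub>0 * C\<^sub>1 * C\<^sub>2 * w z * E n)"
      using w_int by (intro integral_mono integrable_norm H_int H_le) simp
    also have "\<dots> = C\<^sub>0 * C\<^sub>1 * C\<^sub>2 * (LINT z|?M. w z) * E n"
      by simp
    finally show "norm (LINT z|?M. norm (H n z)) \<le> C\<^sub>0 * C\<^sub>1 * C\<^sub>2 * (LINT z|?M. w z) * E n"
      by (simp add: integral_nonneg_AE)
  qed
  have H_suminf: "(\<Sum>n. H n (x, \<xi>)) = indicator (para e) x * (stft_dist e \<phi> c x \<xi> * cnj (stft \<phi> \<psi> x \<xi>))" for x \<xi>
    unfolding H_def stft_dist prod.case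
    using summable_norm_cancel[OF T_summable[of x \<xi>]]
    by (simp add: suminf_mult suminf_mult2 summable_mult2)
  have sum_int: "integrable ?M (\<lambda>z. \<Sum>n. H n z)"
    by (rule integrable_suminf[OF H_int]) (use H_summable H_norm_summable in auto)
  have sum_val: "(LINT z|?M. (\<Sum>n. H n z)) = (\<Sum>n. LINT z|?M. H n z)"
    by (rule integral_suminf[OF H_int]) (use H_summable H_norm_summable in auto)

  have pair_int: "integrable ?M (\<lambda>(x, \<xi>). indicator (para e) x * (stft_dist e \<phi> c x \<xi> * cnj (stft \<phi> \<psi> x \<xi>)))"
    using sum_int by (simp add: H_suminf case_prod_beta' flip: H_suminf)
  have ind: "indicator (para e \<times> UNIV) z *\<^sub>R (case z of (x, \<xi>) \<Rightarrow> stft_dist e \<phi> c x \<xi> * cnj (stft \<phi> \<psi> x \<xi>)) =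
      (case z of (x, \<xi>) \<Rightarrow> indicator (para e) x * (stft_dist e \<phi> c x \<xi> * cnj (stft \<phi> \<psi> x \<xi>)))" for z
    by (auto simp: indicator_def split: prod.splits)
  show ?integrable
    unfolding set_integrable_def ind using pair_int by (simp add: lborel_prod)

  let ?R = "complex_of_real (measure lborel (para e) * N)"
  \<comment> \<open>Each term is integrated with x inside and \<xi> outside, opposite to the order
    in the claim: only the x-integral first collapses \<open>stft\<close> to a Fourier coefficient
    of \<psi>. Joint integrability of \<open>H n\<close> permits the exchange.\<close>
  have H_val: "(LINT z|?M. H n z) = c (dual_seq n) * cnj (fcoeff e \<psi> (dual_seq n)) * ?R" for n
  proof -
    let ?\<alpha> = "dual_seq n"
    have inner: "(LINT x|lborel. H n (x, \<xi>)) =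
        c ?\<alpha> * complex_of_real (measure lborel (para e)) * cnj (fcoeff e \<psi> ?\<alpha>) * complex_of_real ((cmod (fourier \<phi> (?\<alpha> - \<xi>)))\<^sup>2)" for \<xi>
    proof -
      have "H n (x, \<xi>) = c ?\<alpha> * cnj (fourier \<phi> (?\<alpha> - \<xi>)) *
          cnj (indicator (para e) x * (exp (\<i> * complex_of_real (x \<bullet> (\<xi> - ?\<alpha>))) * stft \<phi> \<psi> x \<xi>))" for x
        by (simp add: H_def T_def exp_cnj indicator_def)
      then have "(LINT x|lborel. H n (x, \<xi>)) = c ?\<alpha> * cnj (fourier \<phi> (?\<alpha> - \<xi>)) *
          cnj (LINT x|lborel. indicator (para e) x * (exp (\<i> * complex_of_real (x \<bullet> (\<xi> - ?\<alpha>))) * stft \<phi> \<psi> x \<xi>))"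
        by (simp only: integral_mult_right_zero Bochner_Integration.integral_cnj)
      also have "\<dots> = c ?\<alpha> * cnj (fourier \<phi> (?\<alpha> - \<xi>)) *
          cnj (complex_of_real (measure lborel (para e)) * fcoeff e \<psi> ?\<alpha> * cnj (fourier \<phi> (?\<alpha> - \<xi>)))"
        by (subst para_integral_stft[OF \<phi>_int \<psi> bdd per dual_seq_in_lattice]) (rule refl)
      finally show ?thesis
        by (simp only: complex_norm_square complex_cnj_mult complex_cnj_complex_of_real complex_cnj_cnj mult_ac)
    qed
    have "(LINT z|?M. H n z) = (LINT \<xi>|lborel. (LINT x|lborel. H n (x, \<xi>)))"
      using lborel_pair.integral_snd[of "\<lambda>x \<xi>. H n (x, \<xi>)"] H_int[of n] by simp
    also have "\<dots> = c ?\<alpha> * complex_of_real (measure lborel (para e)) * cnj (fcoeff e \<psi> ?\<alpha>) * complex_of_real N"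
      unfolding inner by (simp only: integral_mult_right_zero integral_complex_of_real plancherel_shift)
    finally show ?thesis
      by (simp add: mult_ac)
  qed
  have R: "?R \<noteq> 0"
    using N measure_para_pos by simp
  \<comment> \<open>Absolute convergence of the pairing is read off from the summable integrals by
    dividing by the nonzero constant \<open>?R\<close>, not from a decay estimate for Fourier
    coefficients.\<close>
  have coeff_summable: "summable (\<lambda>n. norm (c (dual_seq n) * cnj (fcoeff e \<psi> (dual_seq n))))"
  proof -
    have "summable (\<lambda>n. norm (LINT z|?M. H n z))"
      by (rule summable_comparison_test[OF _ H_norm_summable]) (use integral_norm_bound in auto)
    then have "summable (\<lambda>n. norm (LINT z|?M. H n z) * inverse (norm ?R))"
      by (rule summable_mult2)
    then show ?thesis
      using R unfolding H_val by (simp add: norm_mult field_simps)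
  qed
  have "(LINT x:para e|lborel. (LINT \<xi>|lborel. stft_dist e \<phi> c x \<xi> * cnj (stft \<phi> \<psi> x \<xi>))) =
      (LINT x|lborel. (LINT \<xi>|lborel. indicator (para e) x * (stft_dist e \<phi> c x \<xi> * cnj (stft \<phi> \<psi> x \<xi>))))"
    unfolding set_lebesgue_integral_def
    by (intro Bochner_Integration.integral_cong) (auto simp: indicator_def)
  also have "\<dots> = (LINT z|?M. (\<Sum>n. H n z))"
    using lborel_pair.integral_fst[OF pair_int] by (simp add: H_suminf case_prod_beta' flip: H_suminf)
  also have "\<dots> = (\<Sum>n. c (dual_seq n) * cnj (fcoeff e \<psi> (dual_seq n)) * ?R)"
    unfolding sum_val H_val ..
  also have "\<dots> = (\<Sum>n. c (dual_seq n) * cnj (fcoeff e \<psi> (dual_seq n))) * ?R"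
    by (rule suminf_mult2[OF summable_norm_cancel[OF coeff_summable], symmetric])
  also have "(\<Sum>n. c (dual_seq n) * cnj (fcoeff e \<psi> (dual_seq n))) = per_pair e c \<psi>"
    unfolding per_pair_def by (rule infsum_lattice_dual[OF coeff_summable, symmetric])
  finally have eq: "(LINT x:para e|lborel. (LINT \<xi>|lborel. stft_dist e \<phi> c x \<xi> * cnj (stft \<phi> \<psi> x \<xi>))) =
      per_pair e c \<psi> * ?R" .
  show ?formula
    unfolding eq N_def[symmetric] using N measure_para_pos by (simp add: field_simps)
qed

text \<open>Derivatives of a periodic function are periodic, so the estimate on the compact
  parallelepiped is already global.\<close>

lemma Gevrey_per_bound:
  assumes per: "periodic_on_lattice e \<psi>"
    and bound: "\<And>\<alpha> x. x \<in> para e \<Longrightarrow> cmod (dmi \<alpha> \<psi> x) \<le> C * h ^ mi_abs \<alpha> * mi_fact \<alpha> powr s"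
    and h: "h > 0"
  obtains A where "A \<ge> 0" "\<And>i n y. cmod (pderivs (replicate n i) \<psi> y) \<le> A * h ^ n * fact n powr s"
proof
  fix i n y
  show "cmod (pderivs (replicate n i) \<psi> y) \<le> max C 0 * h ^ n * fact n powr s"
  proof (rule periodic_para_bound[OF pderivs_periodic[OF per]])
    fix x assume "x \<in> para e"
    then have "cmod (pderivs (replicate n i) \<psi> x) \<le> C * h ^ n * fact n powr s"
      using bound[of x "\<lambda>j. if j = i then n else 0"] by (simp add: dmi_single mi_abs_single mi_fact_single)
    also have "\<dots> \<le> max C 0 * h ^ n * fact n powr s"
      using h by (intro mult_right_mono) auto
    finally show "cmod (pderivs (replicate n i) \<psi> x) \<le> max C 0 * h ^ n * fact n powr s" .
  qed
qed simp

text \<open>The equation for \<epsilon> says that 4 * 2^(1/s) * \<epsilon> is exactly the rate (s/2)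
  (d (a + b))^(-1/s) produced by the Fourier decay estimate. As an equation it can be solved for
  \<epsilon> or for the radii, so both halves of the theorem reduce to this lemma.\<close>

lemma stft_moyal_bounds:
  fixes \<phi> \<psi> c :: "real^'n \<Rightarrow> complex" and \<epsilon> s a b :: real
  assumes smooth: "smooth \<phi>" "smooth \<psi>"
    and nz: "\<phi> \<noteq> (\<lambda>_. 0)" and per: "periodic_on_lattice e \<psi>"
    and \<phi>_bound: "\<And>\<alpha> \<beta> x. cmod (of_real (mi_pow x \<beta>) * dmi \<alpha> \<phi> x)
        \<le> B * b ^ (mi_abs \<alpha> + mi_abs \<beta>) * mi_fact \<alpha> powr s * mi_fact \<beta> powr t"
    and \<psi>_bound: "\<And>\<alpha> x. x \<in> para e \<Longrightarrow> cmod (dmi \<alpha> \<psi> x) \<le> A * a ^ mi_abs \<alpha> * mi_fact \<alpha> powr s"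
    and c: "\<And>\<alpha>. \<alpha> \<in> lattice (dual_basis e) \<Longrightarrow> cmod (c \<alpha>) \<le> C * exp (\<epsilon> * norm \<alpha> powr (1 / s))"
    and pos: "a > 0" "b > 0" "s > 0"
    and \<epsilon>: "\<epsilon> = s / (8 * 2 powr (1 / s)) * (1 / (real CARD('n) * (a + b))) powr (1 / s)"
  shows "set_integrable lborel (para e \<times> UNIV)
            (\<lambda>(x, \<xi>). stft_dist e \<phi> c x \<xi> * cnj (stft \<phi> \<psi> x \<xi>)) \<and>
         per_pair e c \<psi> =
            inverse (complex_of_real ((LINT y|lborel. (cmod (\<phi> y))\<^sup>2) * measure lborel (para e))) *
            (LINT x:para e|lborel. (LINT \<xi>|lborel. stft_dist e \<phi> c x \<xi> * cnj (stft \<phi> \<psi> x \<xi>)))"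
proof -
  obtain A' where A': "A' \<ge> 0" "\<And>i n y. cmod (pderivs (replicate n i) \<psi> y) \<le> A' * a ^ n * fact n powr s"
    using Gevrey_per_bound[OF per \<psi>_bound \<open>a > 0\<close>] by metis
  obtain B' where B': "B' \<ge> 0"
    "\<And>i n y. cmod (pderivs (replicate n i) \<phi> y) \<le> B' * b ^ n * fact n powr s * decay_weight y"
    using GS_directional_bound[OF \<phi>_bound] by metis
  define \<delta> where "\<delta> = 4 * 2 powr (1 / s) * \<epsilon>"
  let ?W = "LINT y|lborel. decay_weight (y :: real^'n)"
  have \<delta>_eq: "(s / 2) * (r / (real CARD('n) * (a + b))) powr (1 / s) = \<delta> * r powr (1 / s)" if "r \<ge> 0" for r
  proof -
    have "(r * (1 / (real CARD('n) * (a + b)))) powr (1 / s) = r powr (1 / s) * (1 / (real CARD('n) * (a + b))) powr (1 / s)"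
      by (rule powr_mult)
    then show ?thesis
      by (simp add: \<delta>_def \<epsilon>)
  qed
  \<comment> \<open>Enlarging the radius \<open>b\<close> to \<open>a + b\<close> gives the
    transform of \<phi> the same rate \<delta> as \<open>stft\<close>.\<close>
  have B'': "cmod (pderivs (replicate n i) \<phi> y) \<le> B' * (a + b) ^ n * fact n powr s * decay_weight y" for i n y
  proof -
    have "B' * b ^ n * fact n powr s * decay_weight y \<le> B' * (a + b) ^ n * fact n powr s * decay_weight y"
      using pos B' decay_weight_pos[of y] by (intro mult_right_mono mult_left_mono power_mono) auto
    then show ?thesis
      using B'(2) order_trans by blast
  qed
  have cont: "continuous_on UNIV f" if "smooth f" for f :: "real^'n \<Rightarrow> complex"
    using that unfolding smooth_def by (metis pderivs.simps(1))
  have \<epsilon>0: "\<epsilon> > 0"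
    using pos by (simp add: \<epsilon>)
  have F: "cmod (fourier \<phi> \<xi>) \<le> B' * ?W * 2 powr s * exp (- \<delta> * norm \<xi> powr (1 / s))" for \<xi>
    using window_fourier_decay[OF smooth(1) B'' B'(1), of \<xi>] pos \<delta>_eq[of "norm \<xi>"] by simp
  have V: "cmod (stft \<phi> \<psi> x \<xi>) \<le> A' * B' * ?W * 2 powr s * exp (- \<delta> * norm \<xi> powr (1 / s))" for x \<xi>
    using stft_decay[OF smooth B'(2) A'(2) A'(1) B'(1) pos, of x \<xi>] \<delta>_eq[of "norm \<xi>"] by simp
  have \<phi>_decay: "cmod (\<phi> y) \<le> B' * decay_weight y" for y
    using B'(2)[of 0 undefined y] by simp
  have \<psi>_bdd: "cmod (\<psi> y) \<le> A'" for y
    using A'(2)[of 0 undefined y] by simp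
  show ?thesis
    using stft_moyal[OF cont[OF smooth(1)] \<phi>_decay nz cont[OF smooth(2)] \<psi>_bdd per \<epsilon>0 _ \<delta>_def c F V] pos
    by simp
qed

end

theorem theorem3p2:
  fixes e :: "'n::finite \<Rightarrow> real^'n" and s t :: real
  assumes "independent (range e)" and "inj e"
    and "s > 0" and "t > 0" and "s + t \<ge> 1"
  shows "(\<forall>c \<psi> \<phi>. c \<in> Gevrey_per_dual e s \<and> \<psi> \<in> Gevrey_per e s \<and>
            \<phi> \<in> GS_S s t \<and> \<phi> \<noteq> (\<lambda>_. 0) \<longrightarrow>
          set_integrable lborel (para e \<times> UNIV)
            (\<lambda>(x, \<xi>). stft_dist e \<phi> c x \<xi> * cnj (stft \<phi> \<psi> x \<xi>)) \<and>
          per_pair e c \<psi> =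
            inverse (complex_of_real ((LINT y|lborel. (cmod (\<phi> y))\<^sup>2) * measure lborel (para e))) *
            (LINT x:para e|lborel. (LINT \<xi>|lborel. stft_dist e \<phi> c x \<xi> * cnj (stft \<phi> \<psi> x \<xi>))))
       \<and> (\<forall>c \<psi> \<phi>. c \<in> Gevrey0_per_dual e s \<and> \<psi> \<in> Gevrey0_per e s \<and>
            \<phi> \<in> GS_Sigma s t \<and> \<phi> \<noteq> (\<lambda>_. 0) \<longrightarrow>
          set_integrable lborel (para e \<times> UNIV)
            (\<lambda>(x, \<xi>). stft_dist e \<phi> c x \<xi> * cnj (stft \<phi> \<psi> x \<xi>)) \<and>
          per_pair e c \<psi> =
            inverse (complex_of_real ((LINT y|lborel. (cmod (\<phi> y))\<^sup>2) * measure lborel (para e))) *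
            (LINT x:para e|lborel. (LINT \<xi>|lborel. stft_dist e \<phi> c x \<xi> * cnj (stft \<phi> \<psi> x \<xi>))))"
proof (rule conjI; intro allI impI; elim conjE)
  interpret lattice_basis e
    using assms by unfold_locales
  {
    fix c \<psi> \<phi> :: "real^'n \<Rightarrow> complex"
    assume c: "c \<in> Gevrey_per_dual e s" and \<psi>: "\<psi> \<in> Gevrey_per e s" and \<phi>: "\<phi> \<in> GS_S s t" "\<phi> \<noteq> (\<lambda>_. 0)"
    obtain b B where b: "b > 0" "\<And>\<alpha> \<beta> x. cmod (of_real (mi_pow x \<beta>) * dmi \<alpha> \<phi> x)
        \<le> B * b ^ (mi_abs \<alpha> + mi_abs \<beta>) * mi_fact \<alpha> powr s * mi_fact \<beta> powr t"
      using \<phi> unfolding GS_S_def by blast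
    have "\<exists>a>0. \<exists>A. \<forall>\<alpha>. \<forall>x\<in>para e. cmod (dmi \<alpha> \<psi> x) \<le> A * a ^ mi_abs \<alpha> * mi_fact \<alpha> powr s"
      using \<psi> compact_para by (simp add: Gevrey_per_def Gevrey_def)
    then obtain a A where a: "a > 0" "\<And>\<alpha> x. x \<in> para e \<Longrightarrow> cmod (dmi \<alpha> \<psi> x) \<le> A * a ^ mi_abs \<alpha> * mi_fact \<alpha> powr s"
      by blast
    \<comment> \<open>The radii come with \<psi> and \<phi>; the growth condition on
      \<open>c\<close> holds for every positive \<epsilon>, in particular for the one that matches
      them.\<close>
    define \<epsilon> where "\<epsilon> = s / (8 * 2 powr (1 / s)) * (1 / (real CARD('n) * (a + b))) powr (1 / s)"
    have "\<epsilon> > 0"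
      using a b assms by (simp add: \<epsilon>_def)
    then obtain C where C: "\<And>\<alpha>. \<alpha> \<in> lattice (dual_basis e) \<Longrightarrow> cmod (c \<alpha>) \<le> C * exp (\<epsilon> * norm \<alpha> powr (1 / s))"
      using c unfolding Gevrey_per_dual_def by blast
    show "set_integrable lborel (para e \<times> UNIV)
            (\<lambda>(x, \<xi>). stft_dist e \<phi> c x \<xi> * cnj (stft \<phi> \<psi> x \<xi>)) \<and>
          per_pair e c \<psi> =
            inverse (complex_of_real ((LINT y|lborel. (cmod (\<phi> y))\<^sup>2) * measure lborel (para e))) *
            (LINT x:para e|lborel. (LINT \<xi>|lborel. stft_dist e \<phi> c x \<xi> * cnj (stft \<phi> \<psi> x \<xi>)))"
      by (rule stft_moyal_bounds[OF _ _ \<phi>(2) _ b(2) a(2) C a(1) b(1) \<open>s > 0\<close> \<epsilon>_def])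
        (use \<phi> \<psi> in \<open>auto simp: GS_S_def Gevrey_per_def Gevrey_def\<close>)
  }
  {
    fix c \<psi> \<phi> :: "real^'n \<Rightarrow> complex"
    assume c: "c \<in> Gevrey0_per_dual e s" and \<psi>: "\<psi> \<in> Gevrey0_per e s" and \<phi>: "\<phi> \<in> GS_Sigma s t" "\<phi> \<noteq> (\<lambda>_. 0)"
    obtain \<epsilon> C where C: "\<epsilon> > 0" "\<And>\<alpha>. \<alpha> \<in> lattice (dual_basis e) \<Longrightarrow> cmod (c \<alpha>) \<le> C * exp (\<epsilon> * norm \<alpha> powr (1 / s))"
      using c unfolding Gevrey0_per_dual_def by blast
    \<comment> \<open>Here \<epsilon> comes with \<open>c\<close>, and the matching equation with a
      = b = h is solved for \<open>h\<close>; the bounds on \<psi> and \<phi> hold for every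
      positive radius.\<close>
    define h where "h = 1 / (2 * real CARD('n) * (\<epsilon> * (8 * 2 powr (1 / s)) / s) powr s)"
    have h: "h > 0"
      using C assms by (simp add: h_def)
    have "1 / (real CARD('n) * (h + h)) = (\<epsilon> * (8 * 2 powr (1 / s)) / s) powr s"
      by (simp add: h_def)
    then have \<epsilon>: "\<epsilon> = s / (8 * 2 powr (1 / s)) * (1 / (real CARD('n) * (h + h))) powr (1 / s)"
      using C assms by (simp add: powr_powr)
    obtain B where B: "\<And>\<alpha> \<beta> x. cmod (of_real (mi_pow x \<beta>) * dmi \<alpha> \<phi> x)
        \<le> B * h ^ (mi_abs \<alpha> + mi_abs \<beta>) * mi_fact \<alpha> powr s * mi_fact \<beta> powr t"
      using \<phi> h unfolding GS_Sigma_def by blast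
    have "\<exists>A. \<forall>\<alpha>. \<forall>x\<in>para e. cmod (dmi \<alpha> \<psi> x) \<le> A * h ^ mi_abs \<alpha> * mi_fact \<alpha> powr s"
      using \<psi> h compact_para by (simp add: Gevrey0_per_def Gevrey0_def)
    then obtain A where A: "\<And>\<alpha> x. x \<in> para e \<Longrightarrow> cmod (dmi \<alpha> \<psi> x) \<le> A * h ^ mi_abs \<alpha> * mi_fact \<alpha> powr s"
      by blast
    show "set_integrable lborel (para e \<times> UNIV)
            (\<lambda>(x, \<xi>). stft_dist e \<phi> c x \<xi> * cnj (stft \<phi> \<psi> x \<xi>)) \<and>
          per_pair e c \<psi> =
            inverse (complex_of_real ((LINT y|lborel. (cmod (\<phi> y))\<^sup>2) * measure lborel (para e))) *
            (LINT x:para e|lborel. (LINT \<xi>|lborel. stft_dist e \<phi> c x \<xi> * cnj (stft \<phi> \<psi> x \<xi>)))"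
      by (rule stft_moyal_bounds[OF _ _ \<phi>(2) _ B A C(2) h h \<open>s > 0\<close> \<epsilon>])
        (use \<phi> \<psi> in \<open>auto simp: GS_Sigma_def Gevrey0_per_def Gevrey0_def\<close>)
  }
qed

end
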